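(* Let $X$ be a compact Hausdorff space with a regular Borel probability measure $\mu$, let $\alpha\colon L^\infty(X,\mu)\to L^\infty(X,\mu)$ be a $*$-homomorphism, and let $\{S_i\}_{i=1}^N$ and $\{Q_i\}_{i=1}^N$ (with $N<\infty$) be two orthonormal bases for the Hilbert module $\mathcal{E}(X,\mu)$. Then the following are equivalent: (1) the unitary $U=[\langle S_i,Q_j\rangle]_{i,j=1}^N\in M_N(L^\infty(X,\mu))$ that induces a pairing of the bases, i.e. $[Q_1,\dots,Q_N]=[S_1,\dots,S_N]\,U$, is in $M_N(\mathbb{C})$; (2) the maps $\alpha_S$ and $\alpha_Q$ on $\mathcal{B}(L^2(X,\mu))$, given by $\alpha_S(R)=\sum_{i=1}^N S_iRS_i^*$ and $\alpha_Q(R)=\sum_{i=1}^N Q_iRQ_i^*$, coincide.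
   Context: $L^\infty(X,\mu)$ is identified with the algebra of multiplication operators on $L^2(X,\mu)$. Define $\mathcal{E}(X,\mu)=\{T\in\mathcal{B}(L^2(X,\mu)): Ta=\alpha(a)T\text{ for all }a\in L^\infty(X,\mu)\}$, a Hilbert module over $L^\infty(X,\mu)$ with right action $S\cdot a=Sa$ and inner product $\langle S,T\rangle=S^*T\in L^\infty(X,\mu)$. An orthonormal basis of a Hilbert module $\mathcal{M}$ over a unital C*-algebra $A$ is a subset $\{\xi_1,\dots,\xi_N\}$ of $\mathcal{M}$ with $\langle\xi_i,\xi_j\rangle=\delta_{ij}1_A$ and $\xi=\sum_{i=1}^N\xi_i\cdot\langle\xi_i,\xi\rangle$ for all $\xi\in\mathcal{M}$. $M_N(\mathbb{C})$ is viewed inside $M_N(L^\infty(X,\mu))$ as the matrices whose entries are (a.e.) constant functions. *)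

theory Defs
  imports "HOL-Probability.Probability"
begin

definition regular_measure :: "'a::topological_space measure \<Rightarrow> bool" where
  "regular_measure M \<longleftrightarrow>
     (\<forall>B\<in>sets M.
        emeasure M B = (INF U\<in>{U. B \<subseteq> U \<and> open U}. emeasure M U) \<and>
        emeasure M B = (SUP K\<in>{K. K \<subseteq> B \<and> compact K}. emeasure M K))"

text \<open>
  Elements of \<open>L\<^sup>2\<close> and \<open>L\<^sup>\<infinity>\<close> are honest equivalence classes, that is, sets of functions,
  so that equality of vectors, of \<open>L\<^sup>\<infinity>\<close> elements and of operators is equality in HOL.
\<close>

type_synonym 'a fclass = "('a \<Rightarrow> complex) set"

type_synonym 'a operator = "'a fclass \<Rightarrow> 'a fclass"

definition ae_class :: "'a measure \<Rightarrow> ('a \<Rightarrow> complex) \<Rightarrow> 'a fclass" where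
  "ae_class M f = {g \<in> borel_measurable M. AE x in M. g x = f x}"

definition ae_rep :: "'a fclass \<Rightarrow> 'a \<Rightarrow> complex" where
  "ae_rep u = (SOME f. f \<in> u)"

definition ae_const :: "'a measure \<Rightarrow> complex \<Rightarrow> 'a fclass" where
  "ae_const M c = ae_class M (\<lambda>x. c)"

definition ae_add :: "'a measure \<Rightarrow> 'a fclass \<Rightarrow> 'a fclass \<Rightarrow> 'a fclass" where
  "ae_add M u v = ae_class M (\<lambda>x. ae_rep u x + ae_rep v x)"

definition ae_scale :: "'a measure \<Rightarrow> complex \<Rightarrow> 'a fclass \<Rightarrow> 'a fclass" where
  "ae_scale M c u = ae_class M (\<lambda>x. c * ae_rep u x)"

definition ae_mult :: "'a measure \<Rightarrow> 'a fclass \<Rightarrow> 'a fclass \<Rightarrow> 'a fclass" where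
  "ae_mult M u v = ae_class M (\<lambda>x. ae_rep u x * ae_rep v x)"

definition ae_cnj :: "'a measure \<Rightarrow> 'a fclass \<Rightarrow> 'a fclass" where
  "ae_cnj M u = ae_class M (\<lambda>x. cnj (ae_rep u x))"

definition ae_sum :: "'a measure \<Rightarrow> ('i \<Rightarrow> 'a fclass) \<Rightarrow> 'i set \<Rightarrow> 'a fclass" where
  "ae_sum M u I = ae_class M (\<lambda>x. \<Sum>i\<in>I. ae_rep (u i) x)"

definition L2 :: "'a measure \<Rightarrow> 'a fclass set" where
  "L2 M = ae_class M ` {f \<in> borel_measurable M. integrable M (\<lambda>x. (cmod (f x))\<^sup>2)}"

definition Linf :: "'a measure \<Rightarrow> 'a fclass set" where
  "Linf M = ae_class M ` {f \<in> borel_measurable M. \<exists>C. AE x in M. cmod (f x) \<le> C}"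

definition L2_inner :: "'a measure \<Rightarrow> 'a fclass \<Rightarrow> 'a fclass \<Rightarrow> complex" where
  "L2_inner M u v = (LINT x|M. cnj (ae_rep u x) * ae_rep v x)"

definition L2_norm :: "'a measure \<Rightarrow> 'a fclass \<Rightarrow> real" where
  "L2_norm M u = sqrt (LINT x|M. (cmod (ae_rep u x))\<^sup>2)"

definition star_hom_Linf :: "'a measure \<Rightarrow> ('a fclass \<Rightarrow> 'a fclass) \<Rightarrow> bool" where
  "star_hom_Linf M \<alpha> \<longleftrightarrow>
     (\<forall>a\<in>Linf M. \<alpha> a \<in> Linf M) \<and>
     (\<forall>a\<in>Linf M. \<forall>b\<in>Linf M. \<alpha> (ae_add M a b) = ae_add M (\<alpha> a) (\<alpha> b)) \<and>
     (\<forall>c. \<forall>a\<in>Linf M. \<alpha> (ae_scale M c a) = ae_scale M c (\<alpha> a)) \<and>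
     (\<forall>a\<in>Linf M. \<forall>b\<in>Linf M. \<alpha> (ae_mult M a b) = ae_mult M (\<alpha> a) (\<alpha> b)) \<and>
     (\<forall>a\<in>Linf M. \<alpha> (ae_cnj M a) = ae_cnj M (\<alpha> a))"

text \<open>
  Operators are extensional functions on \<^term>\<open>L2 M\<close>; products of operators are written with
  \<^const>\<open>compose\<close>, which keeps them extensional.
\<close>

definition bounded_ops :: "'a measure \<Rightarrow> 'a operator set" where
  "bounded_ops M = {T \<in> L2 M \<rightarrow>\<^sub>E L2 M.
     (\<forall>u\<in>L2 M. \<forall>v\<in>L2 M. T (ae_add M u v) = ae_add M (T u) (T v)) \<and>
     (\<forall>c. \<forall>u\<in>L2 M. T (ae_scale M c u) = ae_scale M c (T u)) \<and>
     (\<exists>K. \<forall>u\<in>L2 M. L2_norm M (T u) \<le> K * L2_norm M u)}"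

definition op_adj :: "'a measure \<Rightarrow> 'a operator \<Rightarrow> 'a operator" where
  "op_adj M T = (THE A. A \<in> bounded_ops M \<and>
     (\<forall>u\<in>L2 M. \<forall>v\<in>L2 M. L2_inner M (A u) v = L2_inner M u (T v)))"

definition op_sum :: "'a measure \<Rightarrow> ('i \<Rightarrow> 'a operator) \<Rightarrow> 'i set \<Rightarrow> 'a operator" where
  "op_sum M T I = (\<lambda>u\<in>L2 M. ae_sum M (\<lambda>i. T i u) I)"

definition mult_op :: "'a measure \<Rightarrow> 'a fclass \<Rightarrow> 'a operator" where
  "mult_op M a = (\<lambda>u\<in>L2 M. ae_mult M a u)"

definition scalar_op :: "'a measure \<Rightarrow> complex \<Rightarrow> 'a operator" where
  "scalar_op M c = mult_op M (ae_const M c)"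

definition intertwiners :: "'a measure \<Rightarrow> ('a fclass \<Rightarrow> 'a fclass) \<Rightarrow> 'a operator set" where
  "intertwiners M \<alpha> = {T \<in> bounded_ops M.
     \<forall>a\<in>Linf M. compose (L2 M) T (mult_op M a) = compose (L2 M) (mult_op M (\<alpha> a)) T}"

text \<open>
  The module inner product \<open>S\<^sup>*T\<close> takes values in \<open>L\<^sup>\<infinity>\<close>, identified with the range of
  \<^term>\<open>mult_op M\<close> on \<^term>\<open>Linf M\<close>; the right action of \<open>L\<^sup>\<infinity>\<close> is composition of operators.
\<close>

definition module_inner :: "'a measure \<Rightarrow> 'a operator \<Rightarrow> 'a operator \<Rightarrow> 'a operator" where
  "module_inner M S T = compose (L2 M) (op_adj M S) T"

definition orthonormal_basis ::
  "'a measure \<Rightarrow> ('a fclass \<Rightarrow> 'a fclass) \<Rightarrow> nat \<Rightarrow> (nat \<Rightarrow> 'a operator) \<Rightarrow> bool" where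
  "orthonormal_basis M \<alpha> N \<xi> \<longleftrightarrow>
     (\<forall>i\<in>{1..N}. \<xi> i \<in> intertwiners M \<alpha>) \<and>
     (\<forall>i\<in>{1..N}. \<forall>j\<in>{1..N}.
        module_inner M (\<xi> i) (\<xi> j) = scalar_op M (if i = j then 1 else 0)) \<and>
     (\<forall>T\<in>intertwiners M \<alpha>.
        T = op_sum M (\<lambda>i. compose (L2 M) (\<xi> i) (module_inner M (\<xi> i) T)) {1..N})"

definition Linf_matrix :: "'a measure \<Rightarrow> nat \<Rightarrow> (nat \<Rightarrow> nat \<Rightarrow> 'a operator) \<Rightarrow> bool" where
  "Linf_matrix M N U \<longleftrightarrow> (\<forall>i\<in>{1..N}. \<forall>j\<in>{1..N}. U i j \<in> mult_op M ` Linf M)"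

definition constant_matrix :: "'a measure \<Rightarrow> nat \<Rightarrow> (nat \<Rightarrow> nat \<Rightarrow> 'a operator) \<Rightarrow> bool" where
  "constant_matrix M N U \<longleftrightarrow> (\<forall>i\<in>{1..N}. \<forall>j\<in>{1..N}. \<exists>c. U i j = scalar_op M c)"

definition unitary_Linf_matrix :: "'a measure \<Rightarrow> nat \<Rightarrow> (nat \<Rightarrow> nat \<Rightarrow> 'a operator) \<Rightarrow> bool" where
  "unitary_Linf_matrix M N U \<longleftrightarrow> Linf_matrix M N U \<and>
     (\<forall>i\<in>{1..N}. \<forall>j\<in>{1..N}.
        op_sum M (\<lambda>k. compose (L2 M) (op_adj M (U k i)) (U k j)) {1..N}
          = scalar_op M (if i = j then 1 else 0) \<and>
        op_sum M (\<lambda>k. compose (L2 M) (U i k) (op_adj M (U j k))) {1..N}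
          = scalar_op M (if i = j then 1 else 0))"

definition induced_map ::
  "'a measure \<Rightarrow> nat \<Rightarrow> (nat \<Rightarrow> 'a operator) \<Rightarrow> 'a operator \<Rightarrow> 'a operator" where
  "induced_map M N S R =
     op_sum M (\<lambda>i. compose (L2 M) (S i) (compose (L2 M) R (op_adj M (S i)))) {1..N}"

end

theory Submission
  imports Defs
begin

text \<open>
  Write \<open>U\<^sub>i\<^sub>j = S\<^sub>i\<^sup>*Q\<^sub>j\<close>.  That \<open>Q\<^sub>j = \<Sum>\<^sub>i S\<^sub>i U\<^sub>i\<^sub>j\<close> is the expansion of \<open>Q\<^sub>j\<close> in the basis \<open>S\<close>, and inserting the
  expansion of one basis in the other between \<open>Q\<^sub>i\<^sup>*\<close> and \<open>Q\<^sub>j\<close>, or between \<open>S\<^sub>i\<^sup>*\<close> and \<open>S\<^sub>j\<close>, gives the two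
  unitarity relations (\<open>transition_matrix_unitary\<close>).  The entries lie in \<open>L\<^sup>\<infinity>\<close> because the product of
  the adjoint of one intertwiner with another commutes with \<open>L\<^sup>\<infinity>\<close>, and every bounded operator on
  \<open>L\<^sup>2\<close> of a finite measure that commutes with \<open>L\<^sup>\<infinity>\<close> is a multiplication (\<open>commutant_of_Linf\<close>).

  The equivalence rests on \<open>\<alpha>\<^sub>Q(R) Q\<^sub>j = Q\<^sub>j R\<close> and \<open>S\<^sub>i\<^sup>* \<alpha>\<^sub>S(R) = R S\<^sub>i\<^sup>*\<close>, both immediate from
  orthonormality.  If \<open>\<alpha>\<^sub>S = \<alpha>\<^sub>Q\<close>, then \<open>U\<^sub>i\<^sub>j R = S\<^sub>i\<^sup>* \<alpha>\<^sub>Q(R) Q\<^sub>j = S\<^sub>i\<^sup>* \<alpha>\<^sub>S(R) Q\<^sub>j = R U\<^sub>i\<^sub>j\<close> for every bounded \<open>R\<close>,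
  and only scalars commute with all rank-one operators.  Conversely, if the \<open>U\<^sub>i\<^sub>j\<close> are scalars, they
  pass through \<open>R\<close> in \<open>\<Sum>\<^sub>j Q\<^sub>j R Q\<^sub>j\<^sup>*\<close> and unitarity collapses the resulting double sum to
  \<open>\<Sum>\<^sub>i S\<^sub>i R S\<^sub>i\<^sup>*\<close>.

  All of this needs adjoints to exist, hence the Riesz representation theorem and the completeness of
  \<open>L\<^sup>2\<close>, which are proved first.  Identities between vectors or operators are reduced throughout to
  identities between inner products (\<open>L2_eqI\<close>, \<open>operator_eqI\<close>).
\<close>

section \<open>Square-integrable functions and their classes\<close>

definition square_integrable :: "'a measure \<Rightarrow> ('a \<Rightarrow> complex) \<Rightarrow> bool" where
  "square_integrable M f \<longleftrightarrow>
     f \<in> borel_measurable M \<and> integrable M (\<lambda>x. (cmod (f x))\<^sup>2)"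

lemma borel_measurable_cnj [measurable (raw)]:
  fixes f :: "'a \<Rightarrow> complex"
  shows "f \<in> borel_measurable M \<Longrightarrow> (\<lambda>x. cnj (f x)) \<in> borel_measurable M"
  by (rule borel_measurable_continuous_on[where f = cnj]) (intro continuous_intros)

lemma cmod_add_square_le: "(cmod (a + b))\<^sup>2 \<le> 2 * (cmod a)\<^sup>2 + 2 * (cmod b)\<^sup>2"
proof -
  have "(cmod (a + b))\<^sup>2 \<le> (cmod a + cmod b)\<^sup>2"
    by (simp add: norm_triangle_ineq power_mono)
  also have "\<dots> \<le> 2 * (cmod a)\<^sup>2 + 2 * (cmod b)\<^sup>2"
    using sum_squares_bound[of "cmod a" "cmod b"] by (simp add: power2_sum)
  finally show ?thesis .
qed

lemma square_integrable_add:
  assumes "square_integrable M f" "square_integrable M g"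
  shows "square_integrable M (\<lambda>x. f x + g x)"
proof -
  have [measurable]: "f \<in> borel_measurable M" "g \<in> borel_measurable M"
    using assms by (auto simp: square_integrable_def)
  have "integrable M (\<lambda>x. 2 * (cmod (f x))\<^sup>2 + 2 * (cmod (g x))\<^sup>2)"
    using assms by (auto simp: square_integrable_def)
  then have "integrable M (\<lambda>x. (cmod (f x + g x))\<^sup>2)"
    by (rule Bochner_Integration.integrable_bound) (auto simp: cmod_add_square_le)
  then show ?thesis
    by (simp add: square_integrable_def)
qed

lemma square_integrable_bounded_mult:
  assumes f: "square_integrable M f"
    and h: "h \<in> borel_measurable M" "AE x in M. cmod (h x) \<le> C"
  shows "square_integrable M (\<lambda>x. h x * f x)"
proof -
  have [measurable]: "f \<in> borel_measurable M" "h \<in> borel_measurable M"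
    using f h by (auto simp: square_integrable_def)
  have "integrable M (\<lambda>x. C\<^sup>2 * (cmod (f x))\<^sup>2)"
    using f by (auto simp: square_integrable_def)
  then have "integrable M (\<lambda>x. (cmod (h x * f x))\<^sup>2)"
  proof (rule Bochner_Integration.integrable_bound)
    show "AE x in M. norm ((cmod (h x * f x))\<^sup>2) \<le> norm (C\<^sup>2 * (cmod (f x))\<^sup>2)"
      using h(2) by eventually_elim
        (auto simp: norm_mult power_mult_distrib intro!: mult_right_mono power_mono)
  qed simp
  then show ?thesis
    by (simp add: square_integrable_def)
qed

lemma square_integrable_scale:
  "square_integrable M f \<Longrightarrow> square_integrable M (\<lambda>x. c * f x)"
  using square_integrable_bounded_mult[of M f "\<lambda>x. c" "cmod c"] by simp

lemma square_integrable_sum: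
  "(\<And>i. i \<in> I \<Longrightarrow> square_integrable M (f i)) \<Longrightarrow> square_integrable M (\<lambda>x. \<Sum>i\<in>I. f i x)"
proof (induction I rule: infinite_finite_induct)
  case (insert i I)
  then show ?case by (simp add: square_integrable_add)
qed (simp_all add: square_integrable_def)

lemma integrable_cnj_mult:
  assumes "square_integrable M f" "square_integrable M g"
  shows "integrable M (\<lambda>x. cnj (f x) * g x)"
proof -
  have [measurable]: "f \<in> borel_measurable M" "g \<in> borel_measurable M"
    using assms by (auto simp: square_integrable_def)
  have bound: "cmod (f x) * cmod (g x) \<le> (cmod (f x))\<^sup>2 + (cmod (g x))\<^sup>2" for x
    using sum_squares_bound[of "cmod (f x)" "cmod (g x)"]
      zero_le_power2[of "cmod (f x)"] zero_le_power2[of "cmod (g x)"] by linarith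
  have "integrable M (\<lambda>x. (cmod (f x))\<^sup>2 + (cmod (g x))\<^sup>2)"
    using assms by (auto simp: square_integrable_def)
  then show ?thesis
  proof (rule Bochner_Integration.integrable_bound)
    show "AE x in M. norm (cnj (f x) * g x) \<le> norm ((cmod (f x))\<^sup>2 + (cmod (g x))\<^sup>2)"
      by (intro AE_I2) (simp add: norm_mult bound)
  qed measurable
qed

lemma ae_class_cong:
  assumes "AE x in M. f x = g x"
  shows "ae_class M f = ae_class M g"
proof -
  have "(AE x in M. h x = f x) \<longleftrightarrow> (AE x in M. h x = g x)" for h
    using assms by (intro eventually_subst) (erule eventually_mono, simp)
  then show ?thesis
    by (simp add: ae_class_def)
qed

lemma ae_class_eqD:
  assumes "ae_class M f = ae_class M g" and "f \<in> borel_measurable M"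
  shows "AE x in M. f x = g x"
proof -
  have "f \<in> ae_class M f"
    using assms(2) by (simp add: ae_class_def)
  then have "f \<in> ae_class M g"
    by (simp only: assms(1))
  then show ?thesis
    by (simp add: ae_class_def)
qed

lemma ae_rep_ae_class:
  assumes "f \<in> borel_measurable M"
  shows "ae_rep (ae_class M f) \<in> borel_measurable M"
    and "AE x in M. ae_rep (ae_class M f) x = f x"
proof -
  have "f \<in> ae_class M f"
    using assms by (simp add: ae_class_def)
  then have "ae_rep (ae_class M f) \<in> ae_class M f"
    unfolding ae_rep_def by (rule someI [where P = "\<lambda>h. h \<in> ae_class M f"])
  then show "ae_rep (ae_class M f) \<in> borel_measurable M"
    and "AE x in M. ae_rep (ae_class M f) x = f x"
    by (auto simp: ae_class_def)
qed

lemma square_integrable_ae_rep_ae_class: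
  assumes "square_integrable M f"
  shows "square_integrable M (ae_rep (ae_class M f))"
proof -
  have [measurable]: "f \<in> borel_measurable M"
    using assms by (auto simp: square_integrable_def)
  note rep [measurable] = ae_rep_ae_class[OF this]
  have "integrable M (\<lambda>x. (cmod (ae_rep (ae_class M f) x))\<^sup>2) \<longleftrightarrow> integrable M (\<lambda>x. (cmod (f x))\<^sup>2)"
  proof (rule integrable_cong_AE)
    show "AE x in M. (cmod (ae_rep (ae_class M f) x))\<^sup>2 = (cmod (f x))\<^sup>2"
      using rep(2) by eventually_elim simp
  qed (use rep(1) in measurable)
  then show ?thesis
    using assms rep(1) by (simp add: square_integrable_def)
qed

lemma ae_class_in_L2: "square_integrable M f \<Longrightarrow> ae_class M f \<in> L2 M"
  by (auto simp: L2_def square_integrable_def)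

lemma L2_rep:
  assumes "u \<in> L2 M"
  shows "square_integrable M (ae_rep u)" and "ae_class M (ae_rep u) = u"
proof -
  obtain f where f: "square_integrable M f" "u = ae_class M f"
    using assms by (auto simp: L2_def square_integrable_def)
  then show "square_integrable M (ae_rep u)"
    by (simp add: square_integrable_ae_rep_ae_class)
  show "ae_class M (ae_rep u) = u"
    unfolding f(2) by (intro ae_class_cong ae_rep_ae_class) (use f in \<open>simp add: square_integrable_def\<close>)
qed

lemma Linf_rep:
  assumes "a \<in> Linf M"
  shows "ae_rep a \<in> borel_measurable M" and "\<exists>C. AE x in M. cmod (ae_rep a x) \<le> C"
    and "ae_class M (ae_rep a) = a"
proof -
  obtain f C where f: "f \<in> borel_measurable M" "AE x in M. cmod (f x) \<le> C" "a = ae_class M f"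
    using assms by (auto simp: Linf_def)
  note rep = ae_rep_ae_class[OF f(1), folded f(3)]
  show "ae_rep a \<in> borel_measurable M" by fact
  have "AE x in M. cmod (ae_rep a x) \<le> C"
    using rep(2) f(2) by eventually_elim simp
  then show "\<exists>C. AE x in M. cmod (ae_rep a x) \<le> C" ..
  show "ae_class M (ae_rep a) = a"
    using ae_class_cong[OF rep(2)] f(3) by simp
qed

lemma ae_class_in_Linf:
  "f \<in> borel_measurable M \<Longrightarrow> AE x in M. cmod (f x) \<le> C \<Longrightarrow> ae_class M f \<in> Linf M"
  by (auto simp: Linf_def)

lemma ae_add_in_L2 [simp]: "u \<in> L2 M \<Longrightarrow> v \<in> L2 M \<Longrightarrow> ae_add M u v \<in> L2 M"
  unfolding ae_add_def by (intro ae_class_in_L2 square_integrable_add L2_rep)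

lemma ae_scale_in_L2 [simp]: "u \<in> L2 M \<Longrightarrow> ae_scale M c u \<in> L2 M"
  unfolding ae_scale_def by (intro ae_class_in_L2 square_integrable_scale L2_rep)

lemma ae_sum_in_L2: "(\<And>i. i \<in> I \<Longrightarrow> u i \<in> L2 M) \<Longrightarrow> ae_sum M u I \<in> L2 M"
  unfolding ae_sum_def by (intro ae_class_in_L2 square_integrable_sum L2_rep)

lemma ae_mult_in_L2 [simp]:
  assumes "a \<in> Linf M" "u \<in> L2 M"
  shows "ae_mult M a u \<in> L2 M"
proof -
  obtain C where "AE x in M. cmod (ae_rep a x) \<le> C"
    using Linf_rep(2)[OF assms(1)] by blast
  then show ?thesis
    unfolding ae_mult_def
    by (intro ae_class_in_L2 square_integrable_bounded_mult L2_rep assms Linf_rep(1))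
qed

section \<open>The inner product\<close>

lemma L2_inner_ae_class_right:
  assumes u: "u \<in> L2 M" and g: "square_integrable M g"
  shows "L2_inner M u (ae_class M g) = (LINT x|M. cnj (ae_rep u x) * g x)"
  unfolding L2_inner_def
proof (rule integral_cong_AE)
  have [measurable]: "g \<in> borel_measurable M" "ae_rep u \<in> borel_measurable M"
    using u g L2_rep(1) by (auto simp: square_integrable_def)
  note rep [measurable] = ae_rep_ae_class[of g M, OF \<open>g \<in> borel_measurable M\<close>]
  show "(\<lambda>x. cnj (ae_rep u x) * ae_rep (ae_class M g) x) \<in> borel_measurable M"
    by measurable
  show "(\<lambda>x. cnj (ae_rep u x) * g x) \<in> borel_measurable M"
    by measurable
  show "AE x in M. cnj (ae_rep u x) * ae_rep (ae_class M g) x = cnj (ae_rep u x) * g x"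
    using rep(2) by eventually_elim simp
qed

lemma L2_inner_commute: "cnj (L2_inner M u v) = L2_inner M v u"
  unfolding L2_inner_def by (subst Bochner_Integration.integral_cnj [symmetric]) (simp add: mult.commute)

lemma L2_inner_add_right [simp]:
  assumes w: "w \<in> L2 M" and u: "u \<in> L2 M" and v: "v \<in> L2 M"
  shows "L2_inner M w (ae_add M u v) = L2_inner M w u + L2_inner M w v"
proof -
  have "L2_inner M w (ae_add M u v) =
      (LINT x|M. cnj (ae_rep w x) * ae_rep u x + cnj (ae_rep w x) * ae_rep v x)"
    unfolding ae_add_def
    by (simp only: L2_inner_ae_class_right[OF w square_integrable_add] L2_rep(1) u v distrib_left)
  also have "\<dots> = L2_inner M w u + L2_inner M w v"
    unfolding L2_inner_def
    by (intro Bochner_Integration.integral_add integrable_cnj_mult L2_rep(1) w u v)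
  finally show ?thesis .
qed

lemma L2_inner_scale_right [simp]:
  assumes w: "w \<in> L2 M" and u: "u \<in> L2 M"
  shows "L2_inner M w (ae_scale M c u) = c * L2_inner M w u"
proof -
  have "L2_inner M w (ae_scale M c u) = (LINT x|M. c * (cnj (ae_rep w x) * ae_rep u x))"
    unfolding ae_scale_def
    by (simp only: L2_inner_ae_class_right[OF w square_integrable_scale] L2_rep(1) u mult.left_commute)
  also have "\<dots> = c * L2_inner M w u"
    unfolding L2_inner_def by (rule integral_mult_right_zero)
  finally show ?thesis .
qed

lemma L2_inner_sum_right:
  assumes w: "w \<in> L2 M" and u: "\<And>i. i \<in> I \<Longrightarrow> u i \<in> L2 M"
  shows "L2_inner M w (ae_sum M u I) = (\<Sum>i\<in>I. L2_inner M w (u i))"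
proof -
  have "L2_inner M w (ae_sum M u I) = (LINT x|M. (\<Sum>i\<in>I. cnj (ae_rep w x) * ae_rep (u i) x))"
    unfolding ae_sum_def
    by (subst L2_inner_ae_class_right[OF w square_integrable_sum])
      (simp_all only: L2_rep(1) u sum_distrib_left)
  also have "\<dots> = (\<Sum>i\<in>I. L2_inner M w (u i))"
    unfolding L2_inner_def
    by (intro Bochner_Integration.integral_sum integrable_cnj_mult L2_rep(1) w u)
  finally show ?thesis .
qed

lemma L2_inner_add_left [simp]:
  assumes "w \<in> L2 M" "u \<in> L2 M" "v \<in> L2 M"
  shows "L2_inner M (ae_add M u v) w = L2_inner M u w + L2_inner M v w"
  using arg_cong[OF L2_inner_add_right[OF assms], where f = cnj] by (simp add: L2_inner_commute)

lemma L2_inner_scale_left [simp]: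
  assumes "w \<in> L2 M" "u \<in> L2 M"
  shows "L2_inner M (ae_scale M c u) w = cnj c * L2_inner M u w"
  using arg_cong[OF L2_inner_scale_right[OF assms, of c], where f = cnj] by (simp add: L2_inner_commute)

lemma L2_inner_self: "L2_inner M u u = of_real ((L2_norm M u)\<^sup>2)"
proof -
  have "L2_inner M u u = (LINT x|M. complex_of_real ((cmod (ae_rep u x))\<^sup>2))"
    unfolding L2_inner_def
    by (intro Bochner_Integration.integral_cong refl) (simp add: complex_norm_square mult.commute del: of_real_power)
  also have "\<dots> = of_real ((L2_norm M u)\<^sup>2)"
    by (simp add: L2_norm_def del: of_real_power)
  finally show ?thesis .
qed

lemma L2_norm_nonneg [simp]: "0 \<le> L2_norm M u"
  by (simp add: L2_norm_def)

lemma L2_norm_ae_class: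
  assumes "square_integrable M f"
  shows "(L2_norm M (ae_class M f))\<^sup>2 = (LINT x|M. (cmod (f x))\<^sup>2)"
proof -
  have [measurable]: "f \<in> borel_measurable M"
    using assms by (simp add: square_integrable_def)
  note rep = ae_rep_ae_class[OF this]
  have "(LINT x|M. (cmod (ae_rep (ae_class M f) x))\<^sup>2) = (LINT x|M. (cmod (f x))\<^sup>2)"
  proof (rule integral_cong_AE)
    show "AE x in M. (cmod (ae_rep (ae_class M f) x))\<^sup>2 = (cmod (f x))\<^sup>2"
      using rep(2) by eventually_elim simp
  qed (use rep(1) in measurable)
  then show ?thesis
    by (simp add: L2_norm_def)
qed

lemma L2_norm_diff:
  assumes u: "u \<in> L2 M" and v: "v \<in> L2 M"
  shows "(L2_norm M (ae_add M u (ae_scale M (-1) v)))\<^sup>2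
    = (LINT x|M. (cmod (ae_rep u x - ae_rep v x))\<^sup>2)"
proof -
  let ?d = "\<lambda>x. ae_rep u x + - 1 * ae_rep v x"
  have d: "square_integrable M ?d"
    by (intro square_integrable_add square_integrable_scale L2_rep(1) u v)
  have [measurable]: "ae_rep v \<in> borel_measurable M"
    using L2_rep(1)[OF v] by (auto simp: square_integrable_def)
  have "ae_add M u (ae_scale M (-1) v) = ae_class M ?d"
    unfolding ae_add_def
  proof (rule ae_class_cong)
    have "AE x in M. ae_rep (ae_scale M (-1) v) x = -1 * ae_rep v x"
      unfolding ae_scale_def by (rule ae_rep_ae_class(2)) measurable
    then show "AE x in M. ae_rep u x + ae_rep (ae_scale M (-1) v) x = ?d x"
      by eventually_elim simp
  qed
  then show ?thesis
    using L2_norm_ae_class[OF d] by simp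
qed

lemma L2_eqI_norm:
  assumes u: "u \<in> L2 M" and v: "v \<in> L2 M"
    and "L2_norm M (ae_add M u (ae_scale M (-1) v)) = 0"
  shows "u = v"
proof -
  have "(LINT x|M. (cmod (ae_rep u x - ae_rep v x))\<^sup>2) = 0"
    using assms(3) L2_norm_diff[OF u v] by simp
  moreover have "integrable M (\<lambda>x. (cmod (ae_rep u x - ae_rep v x))\<^sup>2)"
    using square_integrable_add[OF L2_rep(1)[OF u] square_integrable_scale[OF L2_rep(1)[OF v], of "-1"]]
    by (simp add: square_integrable_def)
  ultimately have "AE x in M. (cmod (ae_rep u x - ae_rep v x))\<^sup>2 = 0"
    by (subst (asm) integral_nonneg_eq_0_iff_AE) auto
  then have "AE x in M. ae_rep u x = ae_rep v x"
    by eventually_elim simp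
  then have "ae_class M (ae_rep u) = ae_class M (ae_rep v)"
    by (rule ae_class_cong)
  then show ?thesis
    by (simp only: L2_rep(2)[OF u] L2_rep(2)[OF v])
qed

text \<open>
  Vectors of \<open>L\<^sup>2\<close> are determined by their inner products.  Since inner products are additive in
  honest complex numbers, this turns every later identity between classes or between operators
  into a computation with finite sums of complex numbers.
\<close>

lemma L2_eqI:
  assumes u: "u \<in> L2 M" and v: "v \<in> L2 M"
    and eq: "\<And>w. w \<in> L2 M \<Longrightarrow> L2_inner M w u = L2_inner M w v"
  shows "u = v"
proof (rule L2_eqI_norm[OF u v])
  let ?d = "ae_add M u (ae_scale M (-1) v)"
  have "L2_inner M ?d ?d = L2_inner M ?d u + -1 * L2_inner M ?d v"
    using u v by (simp del: L2_inner_add_left)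
  also have "\<dots> = 0"
    using u v eq[of ?d] by simp
  finally show "L2_norm M ?d = 0"
    by (simp add: L2_inner_self)
qed

lemma L2_norm_add_square:
  assumes u: "u \<in> L2 M" and v: "v \<in> L2 M"
  shows "(L2_norm M (ae_add M u v))\<^sup>2
    = (L2_norm M u)\<^sup>2 + 2 * Re (L2_inner M u v) + (L2_norm M v)\<^sup>2"
proof -
  have "complex_of_real ((L2_norm M (ae_add M u v))\<^sup>2)
      = L2_inner M u u + (L2_inner M u v + cnj (L2_inner M u v)) + L2_inner M v v"
    using u v by (simp add: L2_inner_self [symmetric] L2_inner_commute del: of_real_power)
  also have "\<dots> = of_real ((L2_norm M u)\<^sup>2 + 2 * Re (L2_inner M u v) + (L2_norm M v)\<^sup>2)"
    by (simp add: L2_inner_self complex_add_cnj)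
  finally show ?thesis
    by (simp only: of_real_eq_iff)
qed

lemma L2_norm_scale:
  assumes "u \<in> L2 M"
  shows "L2_norm M (ae_scale M c u) = cmod c * L2_norm M u"
proof -
  have "complex_of_real ((L2_norm M (ae_scale M c u))\<^sup>2) = (c * cnj c) * L2_inner M u u"
    using assms by (simp add: L2_inner_self [symmetric] mult_ac del: of_real_power)
  also have "\<dots> = of_real ((cmod c * L2_norm M u)\<^sup>2)"
    by (simp add: L2_inner_self complex_norm_square [symmetric] power_mult_distrib)
  finally have "(L2_norm M (ae_scale M c u))\<^sup>2 = (cmod c * L2_norm M u)\<^sup>2"
    by (simp only: of_real_eq_iff)
  then show ?thesis
    by (simp add: power2_eq_iff_nonneg)
qed

lemma L2_Cauchy_Schwarz:
  assumes u: "u \<in> L2 M" and v: "v \<in> L2 M"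
  shows "cmod (L2_inner M u v) \<le> L2_norm M u * L2_norm M v"
proof -
  define p where "p = L2_inner M u v"
  define a where "a = (L2_norm M u)\<^sup>2"
  define b where "b = (L2_norm M v)\<^sup>2"
  \<comment> \<open>The squared norm of \<open>u + t \<langle>v, u\<rangle> v\<close>; the choice \<open>t = -1/\<parallel>v\<parallel>\<^sup>2\<close> removes the component of \<open>u\<close> along \<open>v\<close>.\<close>
  have expand: "0 \<le> a + 2 * t * (cmod p)\<^sup>2 + t\<^sup>2 * (cmod p)\<^sup>2 * b" for t
  proof -
    let ?w = "ae_scale M (t * cnj p) v"
    have "Re (L2_inner M u ?w) = t * (cmod p)\<^sup>2"
      using u v by (simp add: p_def [symmetric] cmod_power2 algebra_simps) (simp add: power2_eq_square)
    moreover have "(L2_norm M ?w)\<^sup>2 = t\<^sup>2 * (cmod p)\<^sup>2 * b"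
      using v by (simp add: L2_norm_scale norm_mult power_mult_distrib b_def)
    ultimately have "(L2_norm M (ae_add M u ?w))\<^sup>2 = a + 2 * t * (cmod p)\<^sup>2 + t\<^sup>2 * (cmod p)\<^sup>2 * b"
      using u v by (subst L2_norm_add_square) (auto simp: a_def)
    then show ?thesis
      by (metis zero_le_power2)
  qed
  have "(cmod p)\<^sup>2 \<le> a * b"
  proof (cases "b = 0")
    case True
    have "(cmod p)\<^sup>2 = 0"
    proof (rule ccontr)
      assume "(cmod p)\<^sup>2 \<noteq> 0"
      then show False
        using expand[of "- (a + 1) / (2 * (cmod p)\<^sup>2)"] True by (simp add: field_simps)
    qed
    then show ?thesis using True by simp
  next
    case False
    then have "b > 0" by (simp add: b_def)
    then show ?thesis
      using expand[of "- 1 / b"] by (simp add: field_simps power2_eq_square)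
  qed
  then have "(cmod p)\<^sup>2 \<le> (L2_norm M u * L2_norm M v)\<^sup>2"
    by (simp add: a_def b_def power_mult_distrib)
  then show ?thesis
    unfolding p_def by (rule power2_le_imp_le) simp
qed


section \<open>Completeness and the Riesz representation theorem\<close>

text \<open>
  Geometric decay of the increments makes the sum of \<open>2\<^sup>n \<bar>f\<^sub>n\<^sub>+\<^sub>1 - f\<^sub>n\<bar>\<^sup>2\<close> integrable, hence finite almost
  everywhere; there the increments decay geometrically, so \<open>f\<^sub>n\<close> converges pointwise.  Fatou's
  lemma then transfers the Cauchy bound to the limit.
\<close>

lemma square_integrable_complete:
  fixes f :: "nat \<Rightarrow> 'a \<Rightarrow> complex"
  assumes sq: "\<And>n. square_integrable M (f n)"
    and Cauchy: "\<And>m n. n \<le> m \<Longrightarrow> (LINT x|M. (cmod (f m x - f n x))\<^sup>2) \<le> c * (1/4) ^ n"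
  obtains g where "square_integrable M g"
    and "\<And>n. (LINT x|M. (cmod (g x - f n x))\<^sup>2) \<le> c * (1/4) ^ n"
proof -
  have [measurable]: "f n \<in> borel_measurable M" for n
    using sq by (simp add: square_integrable_def)
  have diff: "integrable M (\<lambda>x. (cmod (f m x - f n x))\<^sup>2)" for m n
    using square_integrable_add[OF sq[of m] square_integrable_scale[OF sq[of n], of "-1"]]
    by (simp add: square_integrable_def)
  have nn: "(\<integral>\<^sup>+x. ennreal ((cmod (f m x - f n x))\<^sup>2) \<partial>M) \<le> ennreal (c * (1/4) ^ n)" if "n \<le> m" for m n
    by (subst nn_integral_eq_integral[OF diff]) (auto intro!: ennreal_leI Cauchy that)
  have c: "0 \<le> c"
    using order_trans[OF Bochner_Integration.integral_nonneg Cauchy[of 0 0]] by simp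
  define D where "D n x = 2 ^ n * (cmod (f (Suc n) x - f n x))\<^sup>2" for n x
  have D_meas [measurable]: "D n \<in> borel_measurable M" for n
    unfolding D_def by measurable
  have D0: "0 \<le> D n x" for n x
    by (simp add: D_def)
  have D_le: "(\<integral>\<^sup>+x. ennreal (D n x) \<partial>M) \<le> ennreal (c * (1/2) ^ n)" for n
  proof -
    have "(\<integral>\<^sup>+x. ennreal (D n x) \<partial>M) = ennreal (2 ^ n) * (\<integral>\<^sup>+x. ennreal ((cmod (f (Suc n) x - f n x))\<^sup>2) \<partial>M)"
      unfolding D_def by (subst nn_integral_cmult [symmetric]) (auto simp: ennreal_mult)
    also have "\<dots> \<le> ennreal (2 ^ n) * ennreal (c * (1/4) ^ n)"
      by (intro mult_left_mono nn) auto
    also have "\<dots> = ennreal (2 ^ n * (c * (1/4) ^ n))"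
      using c by (simp add: ennreal_mult)
    also have "2 ^ n * (c * (1/4) ^ n) = c * ((2 * (1/4)) ^ n)"
      by (simp only: power_mult_distrib mult_ac)
    finally show ?thesis by simp
  qed
  have "(\<integral>\<^sup>+x. (\<Sum>n. ennreal (D n x)) \<partial>M) = (\<Sum>n. \<integral>\<^sup>+x. ennreal (D n x) \<partial>M)"
    by (rule nn_integral_suminf) measurable
  also have "\<dots> \<le> (\<Sum>n. ennreal (c * (1/2) ^ n))"
    by (intro suminf_le D_le) auto
  also have "\<dots> = ennreal (\<Sum>n. c * (1/2) ^ n)"
    by (intro suminf_ennreal2) (auto simp: c intro!: summable_mult summable_geometric)
  also have "\<dots> < \<infinity>"
    by simp
  finally have "AE x in M. (\<Sum>n. ennreal (D n x)) \<noteq> \<infinity>"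
    by (intro nn_integral_PInf_AE) auto
  then have conv: "AE x in M. (\<lambda>n. f n x) \<longlonglongrightarrow> lim (\<lambda>n. f n x)"
  proof eventually_elim
    fix x
    assume "(\<Sum>n. ennreal (D n x)) \<noteq> \<infinity>"
    then obtain B where B: "0 \<le> B" "(\<Sum>n. ennreal (D n x)) = ennreal B"
      by (cases "\<Sum>n. ennreal (D n x)") auto
    have DB: "D n x \<le> B" for n
    proof -
      have "ennreal (D n x) = (\<Sum>k\<in>{n}. ennreal (D k x))" by simp
      also have "\<dots> \<le> (\<Sum>k. ennreal (D k x))"
        by (rule sum_le_suminf) auto
      finally show ?thesis using B by simp
    qed
    have increment: "norm (f (Suc n) x - f n x) \<le> sqrt B * (1 / sqrt 2) ^ n" for n
    proof (rule power2_le_imp_le)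
      have "((1 / sqrt 2) ^ n)\<^sup>2 = ((1 / sqrt 2)\<^sup>2) ^ n"
        by (simp only: power_mult [symmetric] mult.commute)
      then have "(sqrt B * (1 / sqrt 2) ^ n)\<^sup>2 = B / 2 ^ n"
        using B(1) by (simp add: power_mult_distrib power_divide)
      moreover have "(norm (f (Suc n) x - f n x))\<^sup>2 \<le> B / 2 ^ n"
        using DB[of n] by (simp add: D_def field_simps)
      ultimately show "(norm (f (Suc n) x - f n x))\<^sup>2 \<le> (sqrt B * (1 / sqrt 2) ^ n)\<^sup>2"
        by simp
    qed (use B in simp)
    have "summable (\<lambda>n. sqrt B * (1 / sqrt 2) ^ n)"
      by (intro summable_mult summable_geometric) simp
    then have "summable (\<lambda>n. f (Suc n) x - f n x)"
      by (rule summable_comparison_test') (rule increment)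
    then have "convergent (\<lambda>n. \<Sum>k<n. f (Suc k) x - f k x)"
      by (simp add: summable_iff_convergent)
    then have "convergent (\<lambda>n. f n x - f 0 x)"
      by (simp only: sum_lessThan_telescope[of "\<lambda>n. f n x"])
    then have "convergent (\<lambda>n. f n x)"
      by (metis convergent_diff_const_right_iff)
    then show "(\<lambda>n. f n x) \<longlonglongrightarrow> lim (\<lambda>n. f n x)"
      by (simp add: convergent_LIMSEQ_iff)
  qed
  define g where "g x = lim (\<lambda>n. f n x)" for x
  have [measurable]: "g \<in> borel_measurable M"
    unfolding g_def by measurable
  have Fatou: "(\<integral>\<^sup>+x. ennreal ((cmod (g x - f n x))\<^sup>2) \<partial>M) \<le> ennreal (c * (1/4) ^ n)" for n
  proof -
    have "AE x in M. ennreal ((cmod (g x - f n x))\<^sup>2) = liminf (\<lambda>m. ennreal ((cmod (f m x - f n x))\<^sup>2))"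
      using conv
    proof eventually_elim
      fix x
      assume "(\<lambda>n. f n x) \<longlonglongrightarrow> lim (\<lambda>n. f n x)"
      then have "(\<lambda>m. ennreal ((cmod (f m x - f n x))\<^sup>2)) \<longlonglongrightarrow> ennreal ((cmod (g x - f n x))\<^sup>2)"
        unfolding g_def by (intro tendsto_intros tendsto_ennrealI)
      then show "ennreal ((cmod (g x - f n x))\<^sup>2) = liminf (\<lambda>m. ennreal ((cmod (f m x - f n x))\<^sup>2))"
        by (intro lim_imp_Liminf [symmetric]) simp_all
    qed
    then have "(\<integral>\<^sup>+x. ennreal ((cmod (g x - f n x))\<^sup>2) \<partial>M)
        = (\<integral>\<^sup>+x. liminf (\<lambda>m. ennreal ((cmod (f m x - f n x))\<^sup>2)) \<partial>M)"
      by (rule nn_integral_cong_AE)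
    also have "\<dots> \<le> liminf (\<lambda>m. \<integral>\<^sup>+x. ennreal ((cmod (f m x - f n x))\<^sup>2) \<partial>M)"
      by (rule nn_integral_liminf) measurable
    also have "\<dots> \<le> liminf (\<lambda>m. ennreal (c * (1/4) ^ n))"
      by (intro Liminf_mono eventually_sequentiallyI[of n] nn)
    also have "\<dots> = ennreal (c * (1/4) ^ n)"
      by (simp add: Liminf_const)
    finally show ?thesis .
  qed
  have gf: "integrable M (\<lambda>x. (cmod (g x - f n x))\<^sup>2)" for n
  proof (rule integrableI_nonneg)
    show "(\<integral>\<^sup>+x. ennreal ((cmod (g x - f n x))\<^sup>2) \<partial>M) < \<infinity>"
      by (rule le_less_trans[OF Fatou]) simp
  qed auto
  show thesis
  proof (rule that)
    have "square_integrable M (\<lambda>x. (g x - f 0 x) + f 0 x)"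
      by (intro square_integrable_add sq) (use gf in \<open>simp add: square_integrable_def\<close>)
    then show "square_integrable M g"
      by simp
    show "(LINT x|M. (cmod (g x - f n x))\<^sup>2) \<le> c * (1/4) ^ n" for n
      using Fatou[of n] c by (subst (asm) nn_integral_eq_integral[OF gf]) auto
  qed
qed

lemma L2_complete:
  assumes u: "\<And>n. u n \<in> L2 M"
    and Cauchy: "\<And>m n. n \<le> m \<Longrightarrow>
      (L2_norm M (ae_add M (u m) (ae_scale M (-1) (u n))))\<^sup>2 \<le> c * (1/4) ^ n"
  obtains w where "w \<in> L2 M"
    and "\<And>n. (L2_norm M (ae_add M w (ae_scale M (-1) (u n))))\<^sup>2 \<le> c * (1/4) ^ n"
proof -
  obtain g where g: "square_integrable M g"
    and lim: "\<And>n. (LINT x|M. (cmod (g x - ae_rep (u n) x))\<^sup>2) \<le> c * (1/4) ^ n"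
  proof (rule square_integrable_complete)
    show "square_integrable M (ae_rep (u n))" for n
      by (rule L2_rep(1)[OF u])
    show "(LINT x|M. (cmod (ae_rep (u m) x - ae_rep (u n) x))\<^sup>2) \<le> c * (1/4) ^ n" if "n \<le> m" for m n
      using Cauchy[OF that] by (simp add: L2_norm_diff u)
  qed blast
  show thesis
  proof (rule that)
    show w: "ae_class M g \<in> L2 M"
      using g by (rule ae_class_in_L2)
    fix n
    have [measurable]: "g \<in> borel_measurable M" "ae_rep (u n) \<in> borel_measurable M"
      using g L2_rep(1)[OF u] by (auto simp: square_integrable_def)
    note rep [measurable] = ae_rep_ae_class[of g M, OF \<open>g \<in> borel_measurable M\<close>]
    have "(LINT x|M. (cmod (ae_rep (ae_class M g) x - ae_rep (u n) x))\<^sup>2)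
        = (LINT x|M. (cmod (g x - ae_rep (u n) x))\<^sup>2)"
    proof (rule integral_cong_AE)
      show "AE x in M. (cmod (ae_rep (ae_class M g) x - ae_rep (u n) x))\<^sup>2 = (cmod (g x - ae_rep (u n) x))\<^sup>2"
        using rep(2) by eventually_elim simp
    qed measurable
    then show "(L2_norm M (ae_add M (ae_class M g) (ae_scale M (-1) (u n))))\<^sup>2 \<le> c * (1/4) ^ n"
      using lim[of n] by (simp add: L2_norm_diff[OF w u])
  qed
qed

text \<open>A quadratic that never drops below its value at \<open>0\<close> has no linear term.\<close>

lemma linear_coefficient_zero:
  fixes r b :: real
  assumes b: "0 \<le> b" and nonneg: "\<And>t. 0 \<le> 2 * t * r + t\<^sup>2 * b"
  shows "r = 0"
proof (rule ccontr)
  assume "r \<noteq> 0"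
  define x where "x = r / (b + 1)"
  have r: "r = x * (b + 1)" and x: "x \<noteq> 0"
    using b \<open>r \<noteq> 0\<close> by (auto simp: x_def)
  have "2 * (- x) * r + (- x)\<^sup>2 * b = - (x\<^sup>2 * (b + 2))"
    unfolding r by (simp add: power2_eq_square algebra_simps)
  moreover have "0 < x\<^sup>2 * (b + 2)"
    using b x by simp
  ultimately show False
    using nonneg[of "- x"] by linarith
qed

text \<open>
  The representing vector minimises the energy \<open>\<parallel>u\<parallel>\<^sup>2 - 2 Re \<phi> u\<close>: the parallelogram law makes a fast
  minimising sequence Cauchy, and the vanishing first variation at its limit is the claim.
\<close>

theorem Riesz_representation_L2:
  assumes add: "\<And>u v. u \<in> L2 M \<Longrightarrow> v \<in> L2 M \<Longrightarrow> \<phi> (ae_add M u v) = \<phi> u + \<phi> v"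
    and scale: "\<And>c u. u \<in> L2 M \<Longrightarrow> \<phi> (ae_scale M c u) = c * \<phi> u"
    and bound: "\<And>u. u \<in> L2 M \<Longrightarrow> cmod (\<phi> u) \<le> K * L2_norm M u"
  obtains w where "w \<in> L2 M" and "\<And>v. v \<in> L2 M \<Longrightarrow> L2_inner M w v = \<phi> v"
proof -
  define J where "J u = (L2_norm M u)\<^sup>2 - 2 * Re (\<phi> u)" for u
  have J_bound: "- K\<^sup>2 \<le> J u" if "u \<in> L2 M" for u
  proof -
    have "Re (\<phi> u) \<le> K * L2_norm M u"
      using bound[OF that] complex_Re_le_cmod[of "\<phi> u"] by linarith
    moreover have "0 \<le> (L2_norm M u - K)\<^sup>2" by simp
    ultimately show ?thesis
      by (simp add: J_def power2_diff algebra_simps)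
  qed
  have J_add: "J (ae_add M u (ae_scale M (of_real t) v))
      = J u + 2 * t * Re (L2_inner M u v - \<phi> v) + t\<^sup>2 * (L2_norm M v)\<^sup>2"
    if "u \<in> L2 M" "v \<in> L2 M" for u v t
    using that
    by (simp add: J_def L2_norm_add_square L2_norm_scale add scale power_mult_distrib algebra_simps)
  define m where "m = Inf (J ` L2 M)"
  have m_le: "m \<le> J u" if "u \<in> L2 M" for u
    unfolding m_def by (rule cINF_lower) (use that J_bound in \<open>auto intro!: bdd_belowI2\<close>)
  have "L2 M \<noteq> {}"
    using ae_class_in_L2[of M "\<lambda>x. 0"] by (auto simp: square_integrable_def)
  then have "\<exists>u\<in>L2 M. J u < m + (1/4) ^ n" for n
    using cInf_lessD[of "J ` L2 M" "m + (1/4) ^ n"] by (auto simp: m_def)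
  then obtain u where u: "\<And>n. u n \<in> L2 M" and Ju: "\<And>n. J (u n) < m + (1/4) ^ n"
    by metis
  have parallelogram: "(L2_norm M (ae_add M a (ae_scale M (-1) b)))\<^sup>2 \<le> 2 * J a + 2 * J b - 4 * m"
    if a: "a \<in> L2 M" and b: "b \<in> L2 M" for a b
  proof -
    let ?h = "ae_scale M (1/2) (ae_add M a b)"
    have "4 * J ?h = (L2_norm M a)\<^sup>2 + 2 * Re (L2_inner M a b) + (L2_norm M b)\<^sup>2
        - 4 * Re (\<phi> a) - 4 * Re (\<phi> b)"
      using a b by (simp add: J_def L2_norm_add_square L2_norm_scale add scale power_divide norm_divide field_simps)
    moreover have "m \<le> J ?h"
      using m_le a b by simp
    moreover have "(L2_norm M (ae_add M a (ae_scale M (-1) b)))\<^sup>2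
        = (L2_norm M a)\<^sup>2 - 2 * Re (L2_inner M a b) + (L2_norm M b)\<^sup>2"
      using a b by (simp add: L2_norm_add_square L2_norm_scale)
    ultimately show ?thesis
      using J_def[of a] J_def[of b] by linarith
  qed
  have "(L2_norm M (ae_add M (u j) (ae_scale M (-1) (u n))))\<^sup>2 \<le> 4 * (1/4) ^ n" if "n \<le> j" for n j
  proof -
    have "(1/4 :: real) ^ j \<le> (1/4) ^ n"
      using that by (intro power_decreasing) auto
    then show ?thesis
      using parallelogram[OF u u, of j n] Ju[of j] Ju[of n] by linarith
  qed
  then obtain w where w: "w \<in> L2 M"
    and lim: "\<And>n. (L2_norm M (ae_add M w (ae_scale M (-1) (u n))))\<^sup>2 \<le> 4 * (1/4) ^ n"
    using L2_complete[of u M 4] u by blast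
  have inner_lim: "(\<lambda>n. L2_inner M (u n) v) \<longlonglongrightarrow> L2_inner M w v" if v: "v \<in> L2 M" for v
  proof (rule LIM_zero_cancel, rule Lim_null_comparison)
    show "(\<lambda>n. 2 * (1/2) ^ n * L2_norm M v) \<longlonglongrightarrow> 0"
      by (intro tendsto_mult_left_zero tendsto_mult_right_zero LIMSEQ_power_zero) simp
    have "norm (L2_inner M (u n) v - L2_inner M w v) \<le> 2 * (1/2) ^ n * L2_norm M v" for n
    proof -
      let ?d = "ae_add M w (ae_scale M (-1) (u n))"
      have "L2_norm M ?d \<le> 2 * (1/2) ^ n"
      proof (rule power2_le_imp_le)
        have "(2 * (1/2 :: real) ^ n)\<^sup>2 = 4 * (1/4) ^ n"
          by (simp add: power_mult_distrib power2_eq_square flip: power_mult_distrib)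
        then show "(L2_norm M ?d)\<^sup>2 \<le> (2 * (1/2) ^ n)\<^sup>2"
          using lim[of n] by simp
      qed simp
      have "norm (L2_inner M (u n) v - L2_inner M w v) = norm (L2_inner M ?d v)"
        using u v w by (simp add: norm_minus_commute)
      also have "\<dots> \<le> L2_norm M ?d * L2_norm M v"
        using u v w by (intro L2_Cauchy_Schwarz) auto
      also have "\<dots> \<le> 2 * (1/2) ^ n * L2_norm M v"
        by (intro mult_right_mono \<open>L2_norm M ?d \<le> _\<close>) simp
      finally show ?thesis .
    qed
    then show "\<forall>\<^sub>F n in sequentially. norm (L2_inner M (u n) v - L2_inner M w v) \<le> 2 * (1/2) ^ n * L2_norm M v"
      by simp
  qed
  \<comment> \<open>Near-minimality of \<open>u n\<close> bounds every variation \<open>u n + t v\<close> from below; let \<open>n\<close> tend to infinity.\<close>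
  have Re_zero: "Re (L2_inner M w v - \<phi> v) = 0" if v: "v \<in> L2 M" for v
  proof (rule linear_coefficient_zero[where b = "(L2_norm M v)\<^sup>2"])
    fix t
    have "0 \<le> (1/4) ^ n + 2 * t * Re (L2_inner M (u n) v - \<phi> v) + t\<^sup>2 * (L2_norm M v)\<^sup>2" for n
      using m_le[of "ae_add M (u n) (ae_scale M (of_real t) v)"] J_add[OF u v, of n t] Ju[of n] u v by simp
    moreover have "(\<lambda>n. (1/4) ^ n + 2 * t * Re (L2_inner M (u n) v - \<phi> v) + t\<^sup>2 * (L2_norm M v)\<^sup>2)
        \<longlonglongrightarrow> 0 + 2 * t * Re (L2_inner M w v - \<phi> v) + t\<^sup>2 * (L2_norm M v)\<^sup>2"
      by (intro tendsto_intros inner_lim v LIMSEQ_power_zero) simp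
    ultimately show "0 \<le> 2 * t * Re (L2_inner M w v - \<phi> v) + t\<^sup>2 * (L2_norm M v)\<^sup>2"
      using LIMSEQ_le_const by fastforce
  qed simp
  show thesis
  proof (rule that[OF w])
    fix v assume v: "v \<in> L2 M"
    \<comment> \<open>Multiplying \<open>v\<close> by the imaginary unit turns the imaginary part into a real part.\<close>
    have "Im (L2_inner M w v - \<phi> v) = 0"
      using Re_zero[of "ae_scale M \<i> v"] v w by (simp add: scale)
    then show "L2_inner M w v = \<phi> v"
      using Re_zero[OF v] by (simp add: complex_eq_iff)
  qed
qed

section \<open>Bounded operators and their adjoints\<close>

lemma bounded_op_in_L2: "T \<in> bounded_ops M \<Longrightarrow> u \<in> L2 M \<Longrightarrow> T u \<in> L2 M"
  by (auto simp: bounded_ops_def)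

lemma bounded_op_add:
  "T \<in> bounded_ops M \<Longrightarrow> u \<in> L2 M \<Longrightarrow> v \<in> L2 M \<Longrightarrow> T (ae_add M u v) = ae_add M (T u) (T v)"
  by (auto simp: bounded_ops_def)

lemma bounded_op_scale:
  "T \<in> bounded_ops M \<Longrightarrow> u \<in> L2 M \<Longrightarrow> T (ae_scale M c u) = ae_scale M c (T u)"
  by (auto simp: bounded_ops_def)

lemma bounded_op_bound:
  assumes "T \<in> bounded_ops M"
  obtains K where "0 \<le> K" "\<And>u. u \<in> L2 M \<Longrightarrow> L2_norm M (T u) \<le> K * L2_norm M u"
proof -
  obtain K where K: "\<And>u. u \<in> L2 M \<Longrightarrow> L2_norm M (T u) \<le> K * L2_norm M u"
    using assms unfolding bounded_ops_def by blast
  have "L2_norm M (T u) \<le> \<bar>K\<bar> * L2_norm M u" if "u \<in> L2 M" for u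
    using K[OF that] mult_right_mono[OF abs_ge_self[of K] L2_norm_nonneg[of M u]] by linarith
  then show thesis
    by (intro that[of "\<bar>K\<bar>"]) auto
qed

lemma bounded_opsI:
  assumes "T \<in> L2 M \<rightarrow>\<^sub>E L2 M"
    and "\<And>u v. u \<in> L2 M \<Longrightarrow> v \<in> L2 M \<Longrightarrow> T (ae_add M u v) = ae_add M (T u) (T v)"
    and "\<And>c u. u \<in> L2 M \<Longrightarrow> T (ae_scale M c u) = ae_scale M c (T u)"
    and "\<And>u. u \<in> L2 M \<Longrightarrow> L2_norm M (T u) \<le> K * L2_norm M u"
  shows "T \<in> bounded_ops M"
  unfolding bounded_ops_def
  by (intro CollectI conjI ballI allI exI[of _ K]) (rule assms; assumption)+

lemma bounded_op_PiE: "T \<in> bounded_ops M \<Longrightarrow> T \<in> L2 M \<rightarrow>\<^sub>E L2 M"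
  by (simp add: bounded_ops_def)

lemma operator_eqI:
  assumes A: "A \<in> L2 M \<rightarrow>\<^sub>E L2 M" and B: "B \<in> L2 M \<rightarrow>\<^sub>E L2 M"
    and eq: "\<And>u v. u \<in> L2 M \<Longrightarrow> v \<in> L2 M \<Longrightarrow> L2_inner M v (A u) = L2_inner M v (B u)"
  shows "A = B"
proof (rule PiE_ext[OF A B])
  fix u assume u: "u \<in> L2 M"
  show "A u = B u"
    by (rule L2_eqI[OF PiE_mem[OF A u] PiE_mem[OF B u] eq[OF u]])
qed

lemma compose_PiE:
  "A \<in> L2 M \<rightarrow>\<^sub>E L2 M \<Longrightarrow> B \<in> L2 M \<rightarrow>\<^sub>E L2 M \<Longrightarrow> compose (L2 M) A B \<in> L2 M \<rightarrow>\<^sub>E L2 M"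
  by (auto simp: compose_def)

lemma bounded_ops_compose:
  assumes A: "A \<in> bounded_ops M" and B: "B \<in> bounded_ops M"
  shows "compose (L2 M) A B \<in> bounded_ops M"
proof -
  obtain K where K: "0 \<le> K" "\<And>u. u \<in> L2 M \<Longrightarrow> L2_norm M (A u) \<le> K * L2_norm M u"
    using bounded_op_bound[OF A] by blast
  obtain L where L: "\<And>u. u \<in> L2 M \<Longrightarrow> L2_norm M (B u) \<le> L * L2_norm M u"
    using bounded_op_bound[OF B] by blast
  show ?thesis
  proof (rule bounded_opsI)
    show "compose (L2 M) A B \<in> L2 M \<rightarrow>\<^sub>E L2 M"
      using A B by (intro compose_PiE bounded_op_PiE)
    fix u assume u: "u \<in> L2 M"
    have "L2_norm M (A (B u)) \<le> K * L2_norm M (B u)"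
      by (rule K(2)[OF bounded_op_in_L2[OF B u]])
    also have "\<dots> \<le> K * (L * L2_norm M u)"
      by (rule mult_left_mono[OF L[OF u] K(1)])
    finally show "L2_norm M (compose (L2 M) A B u) \<le> K * L * L2_norm M u"
      using u by (simp add: compose_def mult.assoc)
  qed (use A B in \<open>simp_all add: compose_def bounded_op_in_L2 bounded_op_add bounded_op_scale\<close>)
qed

text \<open>
  \<^const>\<open>op_adj\<close> is a definite description, so it denotes the adjoint only once existence and
  uniqueness are known: the Riesz vector of \<open>v \<mapsto> \<langle>u, T v\<rangle>\<close> is the value at \<open>u\<close>.
\<close>

lemma adjoint_exists:
  assumes T: "T \<in> bounded_ops M"
  shows "\<exists>A\<in>bounded_ops M. \<forall>u\<in>L2 M. \<forall>v\<in>L2 M. L2_inner M (A u) v = L2_inner M u (T v)"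
proof -
  obtain K where K: "0 \<le> K" "\<And>u. u \<in> L2 M \<Longrightarrow> L2_norm M (T u) \<le> K * L2_norm M u"
    using bounded_op_bound[OF T] by blast
  have "\<exists>w. w \<in> L2 M \<and> (\<forall>v\<in>L2 M. L2_inner M w v = L2_inner M u (T v))" if u: "u \<in> L2 M" for u
  proof -
    have "cmod (L2_inner M u (T v)) \<le> (L2_norm M u * K) * L2_norm M v" if v: "v \<in> L2 M" for v
    proof -
      have "cmod (L2_inner M u (T v)) \<le> L2_norm M u * L2_norm M (T v)"
        by (rule L2_Cauchy_Schwarz[OF u bounded_op_in_L2[OF T v]])
      also have "\<dots> \<le> L2_norm M u * (K * L2_norm M v)"
        by (rule mult_left_mono[OF K(2)[OF v] L2_norm_nonneg])
      finally show ?thesis by (simp add: mult.assoc)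
    qed
    note bound = this
    obtain w where "w \<in> L2 M" "\<And>v. v \<in> L2 M \<Longrightarrow> L2_inner M w v = L2_inner M u (T v)"
    proof (rule Riesz_representation_L2[of M "\<lambda>v. L2_inner M u (T v)"])
      show "L2_inner M u (T (ae_add M v w)) = L2_inner M u (T v) + L2_inner M u (T w)"
        if "v \<in> L2 M" "w \<in> L2 M" for v w
        using that u T by (simp add: bounded_op_add bounded_op_in_L2)
      show "L2_inner M u (T (ae_scale M c v)) = c * L2_inner M u (T v)" if "v \<in> L2 M" for c v
        using that u T by (simp add: bounded_op_scale bounded_op_in_L2)
    qed (use bound in blast)+
    then show ?thesis by blast
  qed
  then obtain A0 where A0: "\<And>u. u \<in> L2 M \<Longrightarrow> A0 u \<in> L2 M"
    "\<And>u v. u \<in> L2 M \<Longrightarrow> v \<in> L2 M \<Longrightarrow> L2_inner M (A0 u) v = L2_inner M u (T v)"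
    by metis
  have A0_right: "L2_inner M v (A0 u) = L2_inner M (T v) u" if "u \<in> L2 M" "v \<in> L2 M" for u v
    using arg_cong[OF A0(2)[OF that], where f = cnj] by (simp add: L2_inner_commute)
  have "restrict A0 (L2 M) \<in> bounded_ops M"
  proof (rule bounded_opsI)
    show "restrict A0 (L2 M) \<in> L2 M \<rightarrow>\<^sub>E L2 M"
      using A0(1) by auto
    fix u assume u: "u \<in> L2 M"
    show "restrict A0 (L2 M) (ae_add M u v) = ae_add M (restrict A0 (L2 M) u) (restrict A0 (L2 M) v)"
      if v: "v \<in> L2 M" for v
      using u v by (simp, intro L2_eqI[where M = M]) (simp_all add: A0 A0_right bounded_op_in_L2[OF T])
    show "restrict A0 (L2 M) (ae_scale M c u) = ae_scale M c (restrict A0 (L2 M) u)" for c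
      using u by (simp, intro L2_eqI[where M = M]) (simp_all add: A0 A0_right bounded_op_in_L2[OF T])
    show "L2_norm M (restrict A0 (L2 M) u) \<le> K * L2_norm M u"
    proof (cases "L2_norm M (A0 u) = 0")
      case False
      have "(L2_norm M (A0 u))\<^sup>2 = cmod (L2_inner M u (T (A0 u)))"
        using A0(2)[OF u A0(1)[OF u]] by (simp add: L2_inner_self norm_power flip: A0(2)[OF u A0(1)[OF u]])
      also have "\<dots> \<le> L2_norm M u * L2_norm M (T (A0 u))"
        by (intro L2_Cauchy_Schwarz u bounded_op_in_L2[OF T] A0(1))
      also have "\<dots> \<le> L2_norm M u * (K * L2_norm M (A0 u))"
        by (intro mult_left_mono K(2) A0(1) u L2_norm_nonneg)
      finally have "L2_norm M (A0 u) * L2_norm M (A0 u) \<le> (K * L2_norm M u) * L2_norm M (A0 u)"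
        by (simp add: power2_eq_square mult_ac)
      then have "L2_norm M (A0 u) \<le> K * L2_norm M u"
        using False L2_norm_nonneg[of M "A0 u"] by (simp add: mult_le_cancel_right)
      then show ?thesis using u by simp
    qed (use u K(1) in simp)
  qed
  then show ?thesis
    using A0(2) by (intro bexI[of _ "restrict A0 (L2 M)"]) auto
qed

lemma
  assumes T: "T \<in> bounded_ops M"
  shows op_adj_bounded: "op_adj M T \<in> bounded_ops M"
    and L2_inner_op_adj_left:
      "\<And>u v. u \<in> L2 M \<Longrightarrow> v \<in> L2 M \<Longrightarrow> L2_inner M (op_adj M T u) v = L2_inner M u (T v)"
proof -
  let ?P = "\<lambda>A. A \<in> bounded_ops M \<and>
    (\<forall>u\<in>L2 M. \<forall>v\<in>L2 M. L2_inner M (A u) v = L2_inner M u (T v))"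
  have "\<exists>!A. ?P A"
  proof (rule ex_ex1I)
    show "\<exists>A. ?P A"
      using adjoint_exists[OF T] by blast
    fix A B assume A: "?P A" and B: "?P B"
    show "A = B"
    proof (rule operator_eqI[where M = M])
      fix u v assume "u \<in> L2 M" "v \<in> L2 M"
      then have "L2_inner M (A u) v = L2_inner M (B u) v"
        using A B by simp
      then show "L2_inner M v (A u) = L2_inner M v (B u)"
        by (metis L2_inner_commute)
    qed (use A B in \<open>simp_all add: bounded_op_PiE\<close>)
  qed
  then have "?P (op_adj M T)"
    unfolding op_adj_def by (rule theI')
  then show "op_adj M T \<in> bounded_ops M"
    and "\<And>u v. u \<in> L2 M \<Longrightarrow> v \<in> L2 M \<Longrightarrow> L2_inner M (op_adj M T u) v = L2_inner M u (T v)"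
    by auto
qed

lemma L2_inner_op_adj_right:
  assumes "T \<in> bounded_ops M" "u \<in> L2 M" "v \<in> L2 M"
  shows "L2_inner M v (op_adj M T u) = L2_inner M (T v) u"
  using arg_cong[OF L2_inner_op_adj_left[OF assms], where f = cnj] by (simp add: L2_inner_commute)

lemma op_adj_in_L2: "T \<in> bounded_ops M \<Longrightarrow> u \<in> L2 M \<Longrightarrow> op_adj M T u \<in> L2 M"
  by (rule bounded_op_in_L2[OF op_adj_bounded])

lemma op_sum_PiE:
  "(\<And>i. i \<in> I \<Longrightarrow> T i \<in> L2 M \<rightarrow>\<^sub>E L2 M) \<Longrightarrow> op_sum M T I \<in> L2 M \<rightarrow>\<^sub>E L2 M"
  by (auto simp: op_sum_def intro!: ae_sum_in_L2)

lemma op_sum_cong: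
  "(\<And>i. i \<in> I \<Longrightarrow> T i = T' i) \<Longrightarrow> op_sum M T I = op_sum M T' I"
  by (simp add: op_sum_def ae_sum_def cong: sum.cong)

lemma L2_inner_op_sum:
  assumes "\<And>i. i \<in> I \<Longrightarrow> T i u \<in> L2 M" "u \<in> L2 M" "v \<in> L2 M"
  shows "L2_inner M v (op_sum M T I u) = (\<Sum>i\<in>I. L2_inner M v (T i u))"
  using assms by (simp add: op_sum_def L2_inner_sum_right)

lemma module_inner_apply: "u \<in> L2 M \<Longrightarrow> module_inner M S T u = op_adj M S (T u)"
  by (simp add: module_inner_def compose_def)

lemma module_inner_bounded:
  "S \<in> bounded_ops M \<Longrightarrow> T \<in> bounded_ops M \<Longrightarrow> module_inner M S T \<in> bounded_ops M"
  unfolding module_inner_def by (intro bounded_ops_compose op_adj_bounded)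

lemma op_adj_module_inner:
  assumes S: "S \<in> bounded_ops M" and T: "T \<in> bounded_ops M"
  shows "op_adj M (module_inner M S T) = module_inner M T S"
proof (rule operator_eqI[where M = M])
  fix u v assume u: "u \<in> L2 M" and v: "v \<in> L2 M"
  have "L2_inner M v (op_adj M (module_inner M S T) u) = L2_inner M (T v) (S u)"
    using u v S T
    by (simp add: L2_inner_op_adj_right L2_inner_op_adj_left module_inner_bounded module_inner_apply bounded_op_in_L2)
  then show "L2_inner M v (op_adj M (module_inner M S T) u) = L2_inner M v (module_inner M T S u)"
    using u v S T
    by (simp add: L2_inner_op_adj_right module_inner_apply bounded_op_in_L2)
qed (intro bounded_op_PiE op_adj_bounded module_inner_bounded S T)+

section \<open>Multiplication operators and scalars\<close>

lemma ae_mult_ae_class: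
  assumes [measurable]: "f \<in> borel_measurable M" "g \<in> borel_measurable M"
  shows "ae_mult M (ae_class M f) (ae_class M g) = ae_class M (\<lambda>x. f x * g x)"
  unfolding ae_mult_def
proof (rule ae_class_cong)
  show "AE x in M. ae_rep (ae_class M f) x * ae_rep (ae_class M g) x = f x * g x"
    using ae_rep_ae_class(2)[OF assms(1)] ae_rep_ae_class(2)[OF assms(2)]
    by eventually_elim simp
qed

lemma ae_scale_ae_class:
  assumes "f \<in> borel_measurable M"
  shows "ae_scale M c (ae_class M f) = ae_class M (\<lambda>x. c * f x)"
  unfolding ae_scale_def
proof (rule ae_class_cong)
  show "AE x in M. c * ae_rep (ae_class M f) x = c * f x"
    using ae_rep_ae_class(2)[OF assms] by eventually_elim simp
qed

lemma scalar_op_apply: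
  assumes u: "u \<in> L2 M"
  shows "scalar_op M c u = ae_scale M c u"
proof -
  have "ae_rep u \<in> borel_measurable M"
    using L2_rep(1)[OF u] by (simp add: square_integrable_def)
  then have "ae_mult M (ae_const M c) (ae_class M (ae_rep u)) = ae_scale M c (ae_class M (ae_rep u))"
    by (simp only: ae_const_def ae_mult_ae_class ae_scale_ae_class borel_measurable_const)
  then show ?thesis
    using u by (simp only: scalar_op_def mult_op_def restrict_apply' L2_rep(2)[OF u])
qed

lemma scalar_op_PiE: "scalar_op M c \<in> L2 M \<rightarrow>\<^sub>E L2 M"
proof (rule PiE_I)
  show "scalar_op M c u \<in> L2 M" if "u \<in> L2 M" for u
    using that by (simp add: scalar_op_apply)
qed (simp add: scalar_op_def mult_op_def)

lemma ae_cnj_in_Linf: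
  assumes a: "a \<in> Linf M"
  shows "ae_cnj M a \<in> Linf M"
proof -
  note [measurable] = Linf_rep(1)[OF a]
  obtain C where "AE x in M. cmod (ae_rep a x) \<le> C"
    using Linf_rep(2)[OF a] by blast
  then show ?thesis
    unfolding ae_cnj_def by (intro ae_class_in_Linf[of _ _ C]) simp_all
qed

lemma L2_inner_ae_mult_right:
  assumes a: "a \<in> Linf M" and u: "u \<in> L2 M" and v: "v \<in> L2 M"
  shows "L2_inner M v (ae_mult M a u) = L2_inner M (ae_mult M (ae_cnj M a) v) u"
proof -
  note [measurable] = Linf_rep(1)[OF a]
  have [measurable]: "ae_rep u \<in> borel_measurable M" "ae_rep v \<in> borel_measurable M"
    using L2_rep(1) u v by (auto simp: square_integrable_def)
  have inner_mult: "L2_inner M w (ae_mult M b z) = (LINT x|M. cnj (ae_rep w x) * (ae_rep b x * ae_rep z x))"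
    if b: "b \<in> Linf M" and w: "w \<in> L2 M" and z: "z \<in> L2 M" for b w z
  proof -
    obtain C where "AE x in M. cmod (ae_rep b x) \<le> C"
      using Linf_rep(2)[OF b] by blast
    then show ?thesis
      unfolding ae_mult_def
      by (intro L2_inner_ae_class_right w square_integrable_bounded_mult L2_rep(1) z Linf_rep(1) b)
  qed
  have rep [measurable]: "ae_rep (ae_cnj M a) \<in> borel_measurable M"
    by (rule Linf_rep(1)[OF ae_cnj_in_Linf[OF a]])
  have cnj_rep: "AE x in M. ae_rep (ae_cnj M a) x = cnj (ae_rep a x)"
    unfolding ae_cnj_def by (rule ae_rep_ae_class(2)) measurable
  have "L2_inner M (ae_mult M (ae_cnj M a) v) u = cnj (L2_inner M u (ae_mult M (ae_cnj M a) v))"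
    by (simp add: L2_inner_commute)
  also have "\<dots> = (LINT x|M. cnj (cnj (ae_rep u x) * (ae_rep (ae_cnj M a) x * ae_rep v x)))"
    by (simp only: inner_mult[OF ae_cnj_in_Linf[OF a] u v] Bochner_Integration.integral_cnj)
  also have "\<dots> = (LINT x|M. cnj (ae_rep v x) * (ae_rep a x * ae_rep u x))"
  proof (rule integral_cong_AE)
    show "AE x in M. cnj (cnj (ae_rep u x) * (ae_rep (ae_cnj M a) x * ae_rep v x))
        = cnj (ae_rep v x) * (ae_rep a x * ae_rep u x)"
      using cnj_rep by eventually_elim simp
  qed measurable
  also have "\<dots> = L2_inner M v (ae_mult M a u)"
    by (rule inner_mult[OF a v u, symmetric])
  finally show ?thesis ..
qed

text \<open>
  An operator commuting with every multiplication is determined by its value \<open>b\<close> at the constant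
  function \<open>1\<close>, which is square integrable because the measure is finite: it sends a bounded \<open>h\<close> to
  \<open>h b\<close>.  Testing its norm on the indicator of \<open>{\<bar>b\<bar> > K}\<close> bounds \<open>b\<close>, and cutting a general vector
  off where it exceeds \<open>n\<close> in modulus reduces the formula for all vectors to bounded functions.
\<close>

theorem commutant_of_Linf:
  assumes fin: "finite_measure M" and T: "T \<in> bounded_ops M"
    and comm: "\<And>a u. a \<in> Linf M \<Longrightarrow> u \<in> L2 M \<Longrightarrow> T (ae_mult M a u) = ae_mult M a (T u)"
  shows "T \<in> mult_op M ` Linf M"
proof -
  interpret finite_measure M by fact
  obtain K where K: "0 \<le> K" "\<And>u. u \<in> L2 M \<Longrightarrow> L2_norm M (T u) \<le> K * L2_norm M u"
    using bounded_op_bound[OF T] by blast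
  let ?e = "ae_class M (\<lambda>x. 1)"
  have e: "?e \<in> L2 M"
    by (rule ae_class_in_L2) (simp add: square_integrable_def)
  define b where "b = ae_rep (T ?e)"
  have Te: "T ?e \<in> L2 M"
    by (rule bounded_op_in_L2[OF T e])
  have b: "square_integrable M b" "ae_class M b = T ?e"
    unfolding b_def by (rule L2_rep[OF Te])+
  have [measurable]: "b \<in> borel_measurable M"
    using b(1) by (simp add: square_integrable_def)
  have T_bounded: "T (ae_class M h) = ae_class M (\<lambda>x. h x * b x)"
    if [measurable]: "h \<in> borel_measurable M" and h: "AE x in M. cmod (h x) \<le> C" for h C
  proof -
    have "ae_class M h = ae_mult M (ae_class M h) ?e"
      by (simp add: ae_mult_ae_class)
    then have "T (ae_class M h) = ae_mult M (ae_class M h) (T ?e)"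
      using comm[OF ae_class_in_Linf[OF that] e] by simp
    then show ?thesis
      by (simp add: b(2)[symmetric] ae_mult_ae_class)
  qed
  \<comment> \<open>On \<open>{\<bar>b\<bar> > K}\<close> the function \<open>\<bar>b\<bar>\<^sup>2 - K\<^sup>2\<close> is positive but has integral at most \<open>0\<close>.\<close>
  have b_bound: "AE x in M. cmod (b x) \<le> K"
  proof -
    define h :: "'a \<Rightarrow> complex" where "h x = (if K < cmod (b x) then 1 else 0)" for x
    have [measurable]: "h \<in> borel_measurable M"
      unfolding h_def by measurable
    have h_le: "AE x in M. cmod (h x) \<le> 1"
      by (intro AE_I2) (simp add: h_def)
    have h_sq: "square_integrable M h"
      using square_integrable_bounded_mult[of M "\<lambda>x. 1" h 1] h_le
      by (simp add: square_integrable_def)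
    have hb_sq: "square_integrable M (\<lambda>x. h x * b x)"
      by (rule square_integrable_bounded_mult[OF b(1) _ h_le]) measurable
    have "(L2_norm M (ae_class M (\<lambda>x. h x * b x)))\<^sup>2 \<le> (K * L2_norm M (ae_class M h))\<^sup>2"
      using K(2)[OF ae_class_in_L2[OF h_sq]] T_bounded[OF _ h_le] by (intro power_mono) auto
    then have le: "(LINT x|M. (cmod (h x * b x))\<^sup>2) \<le> K\<^sup>2 * (LINT x|M. (cmod (h x))\<^sup>2)"
      by (simp only: power_mult_distrib L2_norm_ae_class[OF h_sq] L2_norm_ae_class[OF hb_sq])
    have int: "integrable M (\<lambda>x. (cmod (h x * b x))\<^sup>2)" "integrable M (\<lambda>x. K\<^sup>2 * (cmod (h x))\<^sup>2)"
      using h_sq hb_sq by (auto simp: square_integrable_def)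
    have excess: "0 \<le> (cmod (h x * b x))\<^sup>2 - K\<^sup>2 * (cmod (h x))\<^sup>2" for x
      using K(1) by (auto simp: h_def intro!: power_mono)
    have "(LINT x|M. (cmod (h x * b x))\<^sup>2 - K\<^sup>2 * (cmod (h x))\<^sup>2)
        = (LINT x|M. (cmod (h x * b x))\<^sup>2) - K\<^sup>2 * (LINT x|M. (cmod (h x))\<^sup>2)"
      by (simp only: Bochner_Integration.integral_diff[OF int] integral_mult_right_zero)
    moreover have "0 \<le> (LINT x|M. (cmod (h x * b x))\<^sup>2 - K\<^sup>2 * (cmod (h x))\<^sup>2)"
      by (rule Bochner_Integration.integral_nonneg) (rule excess)
    ultimately have "(LINT x|M. (cmod (h x * b x))\<^sup>2 - K\<^sup>2 * (cmod (h x))\<^sup>2) = 0"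
      using le by linarith
    then have "AE x in M. (cmod (h x * b x))\<^sup>2 - K\<^sup>2 * (cmod (h x))\<^sup>2 = 0"
      by (subst (asm) integral_nonneg_eq_0_iff_AE[OF Bochner_Integration.integrable_diff[OF int]])
        (rule AE_I2, rule excess)
    then show ?thesis
    proof eventually_elim
      fix x assume "(cmod (h x * b x))\<^sup>2 - K\<^sup>2 * (cmod (h x))\<^sup>2 = 0"
      then show "cmod (b x) \<le> K"
        using K(1) by (auto simp: h_def power2_eq_iff_nonneg split: if_splits)
    qed
  qed
  have "T ?e \<in> Linf M"
    unfolding b(2)[symmetric] by (rule ae_class_in_Linf[OF _ b_bound]) measurable
  moreover have "T = mult_op M (T ?e)"
  proof (rule PiE_ext[OF bounded_op_PiE[OF T]])
    show "mult_op M (T ?e) \<in> L2 M \<rightarrow>\<^sub>E L2 M"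
      using \<open>T ?e \<in> Linf M\<close> by (auto simp: mult_op_def)
    fix u assume u: "u \<in> L2 M"
    have [measurable]: "ae_rep u \<in> borel_measurable M" "ae_rep (T u) \<in> borel_measurable M"
      using L2_rep(1) u bounded_op_in_L2[OF T u] by (auto simp: square_integrable_def)
    define h :: "nat \<Rightarrow> 'a \<Rightarrow> complex"
      where "h n x = (if cmod (ae_rep u x) \<le> real n then 1 else 0)" for n x
    have [measurable]: "h n \<in> borel_measurable M" for n
      unfolding h_def by measurable
    have "AE x in M. h n x * ae_rep (T u) x = (h n x * ae_rep u x) * b x" for n
    proof -
      have h_Linf: "ae_class M (h n) \<in> Linf M"
        by (rule ae_class_in_Linf[of _ _ 1]) (auto simp: h_def)
      have cut: "ae_mult M (ae_class M (h n)) u = ae_class M (\<lambda>x. h n x * ae_rep u x)"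
        using ae_mult_ae_class[of "h n" M "ae_rep u"] by (simp add: L2_rep(2)[OF u])
      have "ae_class M (\<lambda>x. h n x * ae_rep (T u) x) = ae_mult M (ae_class M (h n)) (T u)"
        using ae_mult_ae_class[of "h n" M "ae_rep (T u)"]
        by (simp add: L2_rep(2)[OF bounded_op_in_L2[OF T u]])
      also have "\<dots> = T (ae_class M (\<lambda>x. h n x * ae_rep u x))"
        using comm[OF h_Linf u] by (simp add: cut)
      also have "\<dots> = ae_class M (\<lambda>x. (h n x * ae_rep u x) * b x)"
        by (rule T_bounded[where C = "real n"]) (auto simp: h_def)
      finally show ?thesis
        by (rule ae_class_eqD) measurable
    qed
    then have "AE x in M. \<forall>n. h n x * ae_rep (T u) x = (h n x * ae_rep u x) * b x"
      unfolding AE_all_countable by (rule allI)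
    then have "AE x in M. ae_rep (T u) x = b x * ae_rep u x"
    proof eventually_elim
      fix x assume *: "\<forall>n. h n x * ae_rep (T u) x = (h n x * ae_rep u x) * b x"
      obtain n where "cmod (ae_rep u x) \<le> real n"
        using real_arch_simple by blast
      then show "ae_rep (T u) x = b x * ae_rep u x"
        using spec[OF *, of n] by (simp add: h_def mult.commute)
    qed
    then have "ae_class M (ae_rep (T u)) = ae_mult M (T ?e) u"
      unfolding ae_mult_def b_def by (rule ae_class_cong)
    then show "T u = mult_op M (T ?e) u"
      using u by (simp add: mult_op_def L2_rep(2)[OF bounded_op_in_L2[OF T u]])
  qed
  ultimately show ?thesis by blast
qed

section \<open>Intertwiners and orthonormal bases\<close>

lemma intertwiner_bounded: "T \<in> intertwiners M \<alpha> \<Longrightarrow> T \<in> bounded_ops M"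
  by (simp add: intertwiners_def)

lemma intertwiner_apply:
  assumes T: "T \<in> intertwiners M \<alpha>" and a: "a \<in> Linf M" and u: "u \<in> L2 M"
  shows "T (ae_mult M a u) = ae_mult M (\<alpha> a) (T u)"
proof -
  have "compose (L2 M) T (mult_op M a) u = compose (L2 M) (mult_op M (\<alpha> a)) T u"
    using T a by (simp add: intertwiners_def)
  then show ?thesis
    using u a bounded_op_in_L2[OF intertwiner_bounded[OF T] u]
    by (simp add: compose_def mult_op_def)
qed

text \<open>
  \<open>S\<^sup>*T\<close> commutes with \<open>L\<^sup>\<infinity>\<close>: moving \<open>a\<close> through \<open>T\<close> turns it into \<open>\<alpha> a\<close>, and moving \<open>\<alpha> a\<close> back through
  \<open>S\<^sup>*\<close> returns \<open>a\<close> because \<open>\<alpha>\<close> preserves conjugation.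
\<close>

lemma module_inner_in_Linf:
  assumes fin: "finite_measure M" and \<alpha>: "star_hom_Linf M \<alpha>"
    and S: "S \<in> intertwiners M \<alpha>" and T: "T \<in> intertwiners M \<alpha>"
  shows "module_inner M S T \<in> mult_op M ` Linf M"
proof (rule commutant_of_Linf[OF fin])
  note SB = intertwiner_bounded[OF S] and TB = intertwiner_bounded[OF T]
  show B: "module_inner M S T \<in> bounded_ops M"
    by (rule module_inner_bounded[OF SB TB])
  fix a u assume a: "a \<in> Linf M" and u: "u \<in> L2 M"
  have \<alpha>a: "\<alpha> a \<in> Linf M" and \<alpha>cnj: "\<alpha> (ae_cnj M a) = ae_cnj M (\<alpha> a)"
    using \<alpha> a by (simp_all add: star_hom_Linf_def)
  note ca = ae_cnj_in_Linf[OF a]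
  note Tu = bounded_op_in_L2[OF TB u]
  show "module_inner M S T (ae_mult M a u) = ae_mult M a (module_inner M S T u)"
  proof (rule L2_eqI[where M = M])
    fix v assume v: "v \<in> L2 M"
    note Sv = bounded_op_in_L2[OF SB v]
    have "L2_inner M v (module_inner M S T (ae_mult M a u)) = L2_inner M (S v) (ae_mult M (\<alpha> a) (T u))"
      using a u v
      by (simp add: module_inner_apply L2_inner_op_adj_right[OF SB] Tu \<alpha>a intertwiner_apply[OF T])
    also have "\<dots> = L2_inner M (ae_mult M (\<alpha> (ae_cnj M a)) (S v)) (T u)"
      by (simp add: L2_inner_ae_mult_right[OF \<alpha>a Tu Sv] \<alpha>cnj)
    also have "\<dots> = L2_inner M (ae_mult M (ae_cnj M a) v) (module_inner M S T u)"
      using v u ca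
      by (simp add: intertwiner_apply[OF S ca v, symmetric] module_inner_apply L2_inner_op_adj_right[OF SB Tu])
    also have "\<dots> = L2_inner M v (ae_mult M a (module_inner M S T u))"
      by (rule L2_inner_ae_mult_right[OF a bounded_op_in_L2[OF B u] v, symmetric])
    finally show "L2_inner M v (module_inner M S T (ae_mult M a u)) = L2_inner M v (ae_mult M a (module_inner M S T u))" .
  qed (use a u in \<open>simp_all add: bounded_op_in_L2[OF B]\<close>)
qed

lemma orthonormal_basis_intertwiner:
  "orthonormal_basis M \<alpha> N \<xi> \<Longrightarrow> i \<in> {1..N} \<Longrightarrow> \<xi> i \<in> intertwiners M \<alpha>"
  by (simp add: orthonormal_basis_def)

lemma orthonormal_basis_bounded:
  "orthonormal_basis M \<alpha> N \<xi> \<Longrightarrow> i \<in> {1..N} \<Longrightarrow> \<xi> i \<in> bounded_ops M"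
  by (rule intertwiner_bounded[OF orthonormal_basis_intertwiner])

lemma orthonormal_basis_inner:
  assumes \<xi>: "orthonormal_basis M \<alpha> N \<xi>" and ij: "i \<in> {1..N}" "j \<in> {1..N}" and u: "u \<in> L2 M"
  shows "op_adj M (\<xi> i) (\<xi> j u) = ae_scale M (if i = j then 1 else 0) u"
proof -
  have "module_inner M (\<xi> i) (\<xi> j) = scalar_op M (if i = j then 1 else 0)"
    using \<xi> ij unfolding orthonormal_basis_def by blast
  then show ?thesis
    using u by (metis module_inner_apply scalar_op_apply)
qed

lemma orthonormal_basis_expansion:
  assumes \<xi>: "orthonormal_basis M \<alpha> N \<xi>" and T: "T \<in> intertwiners M \<alpha>"
    and u: "u \<in> L2 M" and v: "v \<in> L2 M"
  shows "L2_inner M v (T u) = (\<Sum>i\<in>{1..N}. L2_inner M (op_adj M (\<xi> i) v) (op_adj M (\<xi> i) (T u)))"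
proof -
  note \<xi>B = orthonormal_basis_bounded[OF \<xi>]
  have Tu: "T u \<in> L2 M"
    by (rule bounded_op_in_L2[OF intertwiner_bounded[OF T] u])
  have "T = op_sum M (\<lambda>i. compose (L2 M) (\<xi> i) (module_inner M (\<xi> i) T)) {1..N}"
    using \<xi> T unfolding orthonormal_basis_def by blast
  then have "L2_inner M v (T u)
      = L2_inner M v (op_sum M (\<lambda>i. compose (L2 M) (\<xi> i) (module_inner M (\<xi> i) T)) {1..N} u)"
    by (rule arg_cong)
  also have "\<dots> = (\<Sum>i\<in>{1..N}. L2_inner M v (\<xi> i (op_adj M (\<xi> i) (T u))))"
    using u v Tu
    by (subst L2_inner_op_sum) (simp_all add: compose_def module_inner_apply bounded_op_in_L2[OF \<xi>B] op_adj_in_L2[OF \<xi>B])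
  also have "\<dots> = (\<Sum>i\<in>{1..N}. L2_inner M (op_adj M (\<xi> i) v) (op_adj M (\<xi> i) (T u)))"
    using v Tu
    by (intro sum.cong refl) (simp add: L2_inner_op_adj_left[OF \<xi>B] op_adj_in_L2[OF \<xi>B])
  finally show ?thesis .
qed

text \<open>
  Expanding each \<open>\<eta>\<^sub>j\<close> in the basis \<open>\<xi>\<close> gives \<open>\<eta>\<^sub>i\<^sup>*\<eta>\<^sub>j = \<Sum>\<^sub>k \<eta>\<^sub>i\<^sup>*\<xi>\<^sub>k \<xi>\<^sub>k\<^sup>*\<eta>\<^sub>j\<close>.  Both unitarity relations of the
  transition matrix are instances, with the two bases in either role.
\<close>

lemma transition_matrix_unitary:
  assumes \<xi>: "orthonormal_basis M \<alpha> N \<xi>" and \<eta>: "orthonormal_basis M \<alpha> N \<eta>"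
    and i: "i \<in> {1..N}" and j: "j \<in> {1..N}"
  shows "op_sum M (\<lambda>k. compose (L2 M) (module_inner M (\<eta> i) (\<xi> k)) (module_inner M (\<xi> k) (\<eta> j))) {1..N}
    = scalar_op M (if i = j then 1 else 0)"
proof (rule operator_eqI[where M = M])
  note \<xi>B = orthonormal_basis_bounded[OF \<xi>] and \<eta>B = orthonormal_basis_bounded[OF \<eta>]
  show "op_sum M (\<lambda>k. compose (L2 M) (module_inner M (\<eta> i) (\<xi> k)) (module_inner M (\<xi> k) (\<eta> j))) {1..N} \<in> L2 M \<rightarrow>\<^sub>E L2 M"
    by (intro op_sum_PiE compose_PiE bounded_op_PiE module_inner_bounded \<xi>B \<eta>B i j)
  show "scalar_op M (if i = j then 1 else 0) \<in> L2 M \<rightarrow>\<^sub>E L2 M"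
    by (rule scalar_op_PiE)
  fix u v assume u: "u \<in> L2 M" and v: "v \<in> L2 M"
  have \<eta>L: "\<eta> i v \<in> L2 M" "\<eta> j u \<in> L2 M"
    using u v \<eta>B[OF i] \<eta>B[OF j] by (auto intro: bounded_op_in_L2)
  have "L2_inner M v (op_sum M (\<lambda>k. compose (L2 M) (module_inner M (\<eta> i) (\<xi> k)) (module_inner M (\<xi> k) (\<eta> j))) {1..N} u)
      = (\<Sum>k\<in>{1..N}. L2_inner M v (op_adj M (\<eta> i) (\<xi> k (op_adj M (\<xi> k) (\<eta> j u)))))"
    using u v \<eta>L
    by (subst L2_inner_op_sum)
      (simp_all add: compose_def module_inner_apply bounded_op_in_L2[OF \<xi>B] op_adj_in_L2[OF \<xi>B] op_adj_in_L2[OF \<eta>B[OF i]])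
  also have "\<dots> = (\<Sum>k\<in>{1..N}. L2_inner M (op_adj M (\<xi> k) (\<eta> i v)) (op_adj M (\<xi> k) (\<eta> j u)))"
    using v \<eta>L
    by (intro sum.cong refl)
      (simp add: L2_inner_op_adj_left[OF \<xi>B] L2_inner_op_adj_right[OF \<eta>B[OF i]] bounded_op_in_L2[OF \<xi>B] op_adj_in_L2[OF \<xi>B])
  also have "\<dots> = L2_inner M (\<eta> i v) (\<eta> j u)"
    by (rule orthonormal_basis_expansion[OF \<xi> orthonormal_basis_intertwiner[OF \<eta> j] u \<eta>L(1), symmetric])
  also have "\<dots> = L2_inner M v (op_adj M (\<eta> i) (\<eta> j u))"
    by (rule L2_inner_op_adj_right[OF \<eta>B[OF i] \<eta>L(2) v, symmetric])
  also have "op_adj M (\<eta> i) (\<eta> j u) = scalar_op M (if i = j then 1 else 0) u"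
    by (simp only: orthonormal_basis_inner[OF \<eta> i j u] scalar_op_apply[OF u])
  finally show "L2_inner M v (op_sum M (\<lambda>k. compose (L2 M) (module_inner M (\<eta> i) (\<xi> k)) (module_inner M (\<xi> k) (\<eta> j))) {1..N} u)
      = L2_inner M v (scalar_op M (if i = j then 1 else 0) u)" .
qed

section \<open>The induced maps\<close>

lemma L2_inner_induced_map:
  assumes \<xi>: "orthonormal_basis M \<alpha> N \<xi>" and R: "R \<in> bounded_ops M"
    and u: "u \<in> L2 M" and v: "v \<in> L2 M"
  shows "L2_inner M v (induced_map M N \<xi> R u) = (\<Sum>i\<in>{1..N}. L2_inner M v (\<xi> i (R (op_adj M (\<xi> i) u))))"
  unfolding induced_map_def using u v
  by (subst L2_inner_op_sum)
    (simp_all add: compose_def bounded_op_in_L2[OF R] bounded_op_in_L2[OF orthonormal_basis_bounded[OF \<xi>]]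
      op_adj_in_L2[OF orthonormal_basis_bounded[OF \<xi>]])

lemma induced_map_PiE:
  assumes "orthonormal_basis M \<alpha> N \<xi>" "R \<in> bounded_ops M"
  shows "induced_map M N \<xi> R \<in> L2 M \<rightarrow>\<^sub>E L2 M"
  unfolding induced_map_def
  by (intro op_sum_PiE compose_PiE bounded_op_PiE op_adj_bounded assms orthonormal_basis_bounded[OF assms(1)])

text \<open>
  By orthonormality only one summand of \<open>\<Sum>\<^sub>i \<xi>\<^sub>i R \<xi>\<^sub>i\<^sup>*\<close> survives next to \<open>\<xi>\<^sub>j\<close> or \<open>\<xi>\<^sub>j\<^sup>*\<close>: the induced map \<open>\<alpha>\<^sub>\<xi>\<close>
  satisfies \<open>\<alpha>\<^sub>\<xi>(R) \<xi>\<^sub>j = \<xi>\<^sub>j R\<close> and \<open>\<xi>\<^sub>j\<^sup>* \<alpha>\<^sub>\<xi>(R) = R \<xi>\<^sub>j\<^sup>*\<close>.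
\<close>

lemma induced_map_basis:
  assumes \<xi>: "orthonormal_basis M \<alpha> N \<xi>" and R: "R \<in> bounded_ops M"
    and j: "j \<in> {1..N}" and u: "u \<in> L2 M"
  shows "induced_map M N \<xi> R (\<xi> j u) = \<xi> j (R u)"
proof (rule L2_eqI[where M = M])
  note \<xi>B = orthonormal_basis_bounded[OF \<xi>]
  note \<xi>u = bounded_op_in_L2[OF \<xi>B[OF j] u]
  show "induced_map M N \<xi> R (\<xi> j u) \<in> L2 M"
    by (rule PiE_mem[OF induced_map_PiE[OF \<xi> R] \<xi>u])
  show "\<xi> j (R u) \<in> L2 M"
    by (intro bounded_op_in_L2[OF \<xi>B[OF j]] bounded_op_in_L2[OF R] u)
  fix v assume v: "v \<in> L2 M"
  have "L2_inner M v (induced_map M N \<xi> R (\<xi> j u))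
      = (\<Sum>i\<in>{1..N}. (if i = j then 1 else 0) * L2_inner M v (\<xi> i (R u)))"
    unfolding L2_inner_induced_map[OF \<xi> R \<xi>u v]
  proof (intro sum.cong refl)
    fix i assume i: "i \<in> {1..N}"
    show "L2_inner M v (\<xi> i (R (op_adj M (\<xi> i) (\<xi> j u)))) = (if i = j then 1 else 0) * L2_inner M v (\<xi> i (R u))"
      by (simp only: orthonormal_basis_inner[OF \<xi> i j u] bounded_op_scale[OF R u]
          bounded_op_scale[OF \<xi>B[OF i] bounded_op_in_L2[OF R u]]
          L2_inner_scale_right[OF v bounded_op_in_L2[OF \<xi>B[OF i] bounded_op_in_L2[OF R u]]])
  qed
  also have "\<dots> = L2_inner M v (\<xi> j (R u))"
    using j by (simp add: if_distrib[of "\<lambda>c. c * _"] cong: if_cong)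
  finally show "L2_inner M v (induced_map M N \<xi> R (\<xi> j u)) = L2_inner M v (\<xi> j (R u))" .
qed

lemma op_adj_basis_induced_map:
  assumes \<xi>: "orthonormal_basis M \<alpha> N \<xi>" and R: "R \<in> bounded_ops M"
    and j: "j \<in> {1..N}" and u: "u \<in> L2 M"
  shows "op_adj M (\<xi> j) (induced_map M N \<xi> R u) = R (op_adj M (\<xi> j) u)"
proof (rule L2_eqI[where M = M])
  note \<xi>B = orthonormal_basis_bounded[OF \<xi>]
  have y: "R (op_adj M (\<xi> i) u) \<in> L2 M" if "i \<in> {1..N}" for i
    by (intro bounded_op_in_L2[OF R] op_adj_in_L2[OF \<xi>B[OF that]] u)
  have ind: "induced_map M N \<xi> R u \<in> L2 M"
    by (rule PiE_mem[OF induced_map_PiE[OF \<xi> R] u])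
  show "op_adj M (\<xi> j) (induced_map M N \<xi> R u) \<in> L2 M"
    by (rule op_adj_in_L2[OF \<xi>B[OF j] ind])
  show "R (op_adj M (\<xi> j) u) \<in> L2 M"
    by (rule y[OF j])
  fix v assume v: "v \<in> L2 M"
  have "L2_inner M v (op_adj M (\<xi> j) (induced_map M N \<xi> R u))
      = (\<Sum>i\<in>{1..N}. L2_inner M (\<xi> j v) (\<xi> i (R (op_adj M (\<xi> i) u))))"
    using v u ind
    by (simp add: L2_inner_op_adj_right[OF \<xi>B[OF j]] L2_inner_induced_map[OF \<xi> R] bounded_op_in_L2[OF \<xi>B[OF j]])
  also have "\<dots> = (\<Sum>i\<in>{1..N}. (if j = i then 1 else 0) * L2_inner M v (R (op_adj M (\<xi> i) u)))"
  proof (intro sum.cong refl)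
    fix i assume i: "i \<in> {1..N}"
    have "L2_inner M (\<xi> j v) (\<xi> i (R (op_adj M (\<xi> i) u))) = L2_inner M v (op_adj M (\<xi> j) (\<xi> i (R (op_adj M (\<xi> i) u))))"
      by (rule L2_inner_op_adj_right[OF \<xi>B[OF j] bounded_op_in_L2[OF \<xi>B[OF i] y[OF i]] v, symmetric])
    then show "L2_inner M (\<xi> j v) (\<xi> i (R (op_adj M (\<xi> i) u))) = (if j = i then 1 else 0) * L2_inner M v (R (op_adj M (\<xi> i) u))"
      by (simp only: orthonormal_basis_inner[OF \<xi> j i y[OF i]] L2_inner_scale_right[OF v y[OF i]])
  qed
  also have "\<dots> = L2_inner M v (R (op_adj M (\<xi> j) u))"
    using j by (simp add: if_distrib[of "\<lambda>c. c * _"] cong: if_cong)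
  finally show "L2_inner M v (op_adj M (\<xi> j) (induced_map M N \<xi> R u)) = L2_inner M v (R (op_adj M (\<xi> j) u))" .
qed

section \<open>Constant transition matrices\<close>

lemma unit_vector:
  assumes "prob_space M"
  obtains e where "e \<in> L2 M" "L2_inner M e e = 1"
proof
  interpret prob_space M by fact
  have sq: "square_integrable M (\<lambda>x. 1)"
    by (simp add: square_integrable_def)
  show "ae_class M (\<lambda>x. 1) \<in> L2 M"
    using sq by (rule ae_class_in_L2)
  show "L2_inner M (ae_class M (\<lambda>x. 1)) (ae_class M (\<lambda>x. 1)) = 1"
    using L2_norm_ae_class[OF sq] by (simp add: L2_inner_self prob_space flip: of_real_power)
qed

text \<open>
  Commuting \<open>A\<close> with the rank-one operator \<open>u \<mapsto> \<langle>e, u\<rangle> w\<close> and evaluating at the unit vector \<open>e\<close>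
  gives \<open>A w = \<langle>e, A e\<rangle> w\<close>, with a coefficient independent of \<open>w\<close>.
\<close>

lemma commutant_of_bounded_ops:
  assumes e: "e \<in> L2 M" "L2_inner M e e = 1" and A: "A \<in> bounded_ops M"
    and comm: "\<And>R u. R \<in> bounded_ops M \<Longrightarrow> u \<in> L2 M \<Longrightarrow> A (R u) = R (A u)"
  shows "\<exists>c. A = scalar_op M c"
proof (intro exI PiE_ext[OF bounded_op_PiE[OF A] scalar_op_PiE])
  fix w assume w: "w \<in> L2 M"
  define R where "R = (\<lambda>u\<in>L2 M. ae_scale M (L2_inner M e u) w)"
  have R: "R \<in> bounded_ops M"
  proof (rule bounded_opsI)
    show "R \<in> L2 M \<rightarrow>\<^sub>E L2 M"
      using w by (auto simp: R_def)
    fix u assume u: "u \<in> L2 M"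
    show "R (ae_add M u v) = ae_add M (R u) (R v)" if v: "v \<in> L2 M" for v
      using u v w e by (intro L2_eqI[where M = M]) (simp_all add: R_def distrib_right)
    show "R (ae_scale M c u) = ae_scale M c (R u)" for c
      using u w e by (intro L2_eqI[where M = M]) (simp_all add: R_def)
    show "L2_norm M (R u) \<le> (L2_norm M e * L2_norm M w) * L2_norm M u"
      using mult_right_mono[OF L2_Cauchy_Schwarz[OF e(1) u] L2_norm_nonneg[of M w]] u w
      by (simp add: R_def L2_norm_scale mult_ac)
  qed
  have "R e = w"
    using e w by (intro L2_eqI[where M = M]) (simp_all add: R_def)
  then have "A w = R (A e)"
    using comm[OF R e(1)] by simp
  also have "\<dots> = scalar_op M (L2_inner M e (A e)) w"
    using w by (simp add: R_def bounded_op_in_L2[OF A e(1)] scalar_op_apply)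
  finally show "A w = scalar_op M (L2_inner M e (A e)) w" .
qed

text \<open>
  If the two induced maps agree on \<open>R\<close>, then \<open>S\<^sub>i\<^sup>* \<alpha>\<^sub>S(R) Q\<^sub>j = R S\<^sub>i\<^sup>*Q\<^sub>j\<close> and \<open>S\<^sub>i\<^sup>* \<alpha>\<^sub>Q(R) Q\<^sub>j = S\<^sub>i\<^sup>*Q\<^sub>j R\<close>
  coincide, so that the entries of the transition matrix commute with everything.
\<close>

lemma constant_matrix_if_induced_map_eq:
  assumes prob: "prob_space M"
    and S: "orthonormal_basis M \<alpha> N S" and Q: "orthonormal_basis M \<alpha> N Q"
    and eq: "\<And>R. R \<in> bounded_ops M \<Longrightarrow> induced_map M N S R = induced_map M N Q R"
  shows "constant_matrix M N (\<lambda>i j. module_inner M (S i) (Q j))"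
  unfolding constant_matrix_def
proof (intro ballI)
  fix i j assume i: "i \<in> {1..N}" and j: "j \<in> {1..N}"
  obtain e where e: "e \<in> L2 M" "L2_inner M e e = 1"
    using unit_vector[OF prob] by blast
  note SB = orthonormal_basis_bounded[OF S i] and QB = orthonormal_basis_bounded[OF Q j]
  show "\<exists>c. module_inner M (S i) (Q j) = scalar_op M c"
  proof (rule commutant_of_bounded_ops[OF e module_inner_bounded[OF SB QB]])
    fix R u assume R: "R \<in> bounded_ops M" and u: "u \<in> L2 M"
    have "module_inner M (S i) (Q j) (R u) = op_adj M (S i) (induced_map M N Q R (Q j u))"
      by (simp add: module_inner_apply bounded_op_in_L2[OF R u] induced_map_basis[OF Q R j u])
    also have "\<dots> = op_adj M (S i) (induced_map M N S R (Q j u))"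
      by (simp only: eq[OF R])
    also have "\<dots> = R (module_inner M (S i) (Q j) u)"
      by (simp add: module_inner_apply u op_adj_basis_induced_map[OF S R i bounded_op_in_L2[OF QB u]])
    finally show "module_inner M (S i) (Q j) (R u) = R (module_inner M (S i) (Q j) u)" .
  qed
qed

text \<open>
  Substituting \<open>Q\<^sub>j = \<Sum>\<^sub>i c\<^sub>i\<^sub>j S\<^sub>i\<close> with scalars \<open>c\<^sub>i\<^sub>j\<close> into \<open>\<Sum>\<^sub>j Q\<^sub>j R Q\<^sub>j\<^sup>*\<close> gives
  \<open>\<Sum>\<^sub>i\<^sub>,\<^sub>k (\<Sum>\<^sub>j c\<^sub>i\<^sub>j cnj c\<^sub>k\<^sub>j) S\<^sub>i R S\<^sub>k\<^sup>*\<close>, since scalars pass through the linear \<open>R\<close>; unitarity of \<open>c\<close>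
  leaves the diagonal.
\<close>

lemma induced_map_eq_if_constant_matrix:
  assumes prob: "prob_space M"
    and S: "orthonormal_basis M \<alpha> N S" and Q: "orthonormal_basis M \<alpha> N Q"
    and const: "constant_matrix M N (\<lambda>i j. module_inner M (S i) (Q j))"
    and R: "R \<in> bounded_ops M"
  shows "induced_map M N S R = induced_map M N Q R"
proof -
  note SB = orthonormal_basis_bounded[OF S] and QB = orthonormal_basis_bounded[OF Q]
  obtain e where e: "e \<in> L2 M" "L2_inner M e e = 1"
    using unit_vector[OF prob] by blast
  obtain c where c: "\<And>i j. i \<in> {1..N} \<Longrightarrow> j \<in> {1..N} \<Longrightarrow> module_inner M (S i) (Q j) = scalar_op M (c i j)"
    using const unfolding constant_matrix_def by metis
  have SQ: "op_adj M (S i) (Q j u) = ae_scale M (c i j) u"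
    if "i \<in> {1..N}" "j \<in> {1..N}" "u \<in> L2 M" for i j u
    using c[OF that(1,2)] that(3) by (metis module_inner_apply scalar_op_apply)
  have Q_right: "L2_inner M v (Q j u) = (\<Sum>i\<in>{1..N}. c i j * L2_inner M v (S i u))"
    if j: "j \<in> {1..N}" and u: "u \<in> L2 M" and v: "v \<in> L2 M" for j u v
    unfolding orthonormal_basis_expansion[OF S orthonormal_basis_intertwiner[OF Q j] u v]
    using u v j
    by (intro sum.cong refl) (simp add: SQ op_adj_in_L2[OF SB] L2_inner_op_adj_left[OF SB])
  have Q_left: "L2_inner M (Q j u) v = (\<Sum>i\<in>{1..N}. cnj (c i j) * L2_inner M (S i u) v)"
    if "j \<in> {1..N}" "u \<in> L2 M" "v \<in> L2 M" for j u v
    using arg_cong[OF Q_right[OF that], where f = cnj] by (simp add: L2_inner_commute)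
  \<comment> \<open>Evaluating \<open>S\<^sub>i\<^sup>*S\<^sub>k = \<Sum>\<^sub>j (S\<^sub>i\<^sup>*Q\<^sub>j)(Q\<^sub>j\<^sup>*S\<^sub>k)\<close> at a unit vector turns unitarity into an identity of numbers.\<close>
  have unitary: "(\<Sum>j\<in>{1..N}. c i j * cnj (c k j)) = (if i = k then 1 else 0)"
    if i: "i \<in> {1..N}" and k: "k \<in> {1..N}" for i k
  proof -
    have "(if i = k then 1 else 0) = L2_inner M e (op_adj M (S i) (S k e))"
      by (simp only: orthonormal_basis_inner[OF S i k e(1)] L2_inner_scale_right[OF e(1) e(1)] e(2) mult_1_right)
    also have "\<dots> = L2_inner M (S i e) (S k e)"
      by (rule L2_inner_op_adj_right[OF SB[OF i] bounded_op_in_L2[OF SB[OF k] e(1)] e(1)])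
    also have "\<dots> = (\<Sum>j\<in>{1..N}. L2_inner M (op_adj M (Q j) (S i e)) (op_adj M (Q j) (S k e)))"
      by (rule orthonormal_basis_expansion[OF Q orthonormal_basis_intertwiner[OF S k] e(1) bounded_op_in_L2[OF SB[OF i] e(1)]])
    also have "\<dots> = (\<Sum>j\<in>{1..N}. c i j * cnj (c k j))"
    proof (intro sum.cong refl)
      fix j assume j: "j \<in> {1..N}"
      have QS: "op_adj M (Q j) (S l e) = ae_scale M (cnj (c l j)) e" if l: "l \<in> {1..N}" for l
      proof (rule L2_eqI[where M = M])
        note Sl = bounded_op_in_L2[OF SB[OF l] e(1)]
        show "op_adj M (Q j) (S l e) \<in> L2 M"
          by (rule op_adj_in_L2[OF QB[OF j] Sl])
        show "ae_scale M (cnj (c l j)) e \<in> L2 M"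
          using e by simp
        fix v assume v: "v \<in> L2 M"
        note Qv = bounded_op_in_L2[OF QB[OF j] v]
        have "L2_inner M v (op_adj M (Q j) (S l e)) = L2_inner M (op_adj M (S l) (Q j v)) e"
          by (simp only: L2_inner_op_adj_right[OF QB[OF j] Sl v] L2_inner_op_adj_left[OF SB[OF l] Qv e(1)])
        then show "L2_inner M v (op_adj M (Q j) (S l e)) = L2_inner M v (ae_scale M (cnj (c l j)) e)"
          using v e by (simp add: SQ[OF l j v])
      qed
      show "L2_inner M (op_adj M (Q j) (S i e)) (op_adj M (Q j) (S k e)) = c i j * cnj (c k j)"
        using e by (simp add: QS[OF i] QS[OF k])
    qed
    finally show ?thesis ..
  qed
  show ?thesis
  proof (rule operator_eqI[OF induced_map_PiE[OF S R] induced_map_PiE[OF Q R]])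
    fix u v assume u: "u \<in> L2 M" and v: "v \<in> L2 M"
    have Su: "op_adj M (S k) u \<in> L2 M" if "k \<in> {1..N}" for k
      by (rule op_adj_in_L2[OF SB[OF that] u])
    have Qu: "op_adj M (Q j) u \<in> L2 M" if "j \<in> {1..N}" for j
      by (rule op_adj_in_L2[OF QB[OF that] u])
    \<comment> \<open>Moving \<open>S\<^sub>i R\<close> to the left slot exposes \<open>Q\<^sub>j\<^sup>*\<close>, whose expansion is read off from that of \<open>Q\<^sub>j\<close>.\<close>
    have SRQ: "L2_inner M v (S i (R (op_adj M (Q j) u)))
        = (\<Sum>k\<in>{1..N}. cnj (c k j) * L2_inner M v (S i (R (op_adj M (S k) u))))"
      if i: "i \<in> {1..N}" and j: "j \<in> {1..N}" for i j
    proof -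
      define z where "z = op_adj M R (op_adj M (S i) v)"
      have z: "z \<in> L2 M"
        unfolding z_def by (intro op_adj_in_L2[OF R] op_adj_in_L2[OF SB[OF i]] v)
      have shift: "L2_inner M v (S i (R x)) = L2_inner M z x" if x: "x \<in> L2 M" for x
        unfolding z_def
        by (simp only: L2_inner_op_adj_left[OF R op_adj_in_L2[OF SB[OF i] v] x]
            L2_inner_op_adj_left[OF SB[OF i] v bounded_op_in_L2[OF R x]])
      have "L2_inner M v (S i (R (op_adj M (Q j) u))) = L2_inner M (Q j z) u"
        by (simp only: shift[OF Qu[OF j]] L2_inner_op_adj_right[OF QB[OF j] u z])
      also have "\<dots> = (\<Sum>k\<in>{1..N}. cnj (c k j) * L2_inner M (S k z) u)"
        by (rule Q_left[OF j z u])
      also have "\<dots> = (\<Sum>k\<in>{1..N}. cnj (c k j) * L2_inner M v (S i (R (op_adj M (S k) u))))"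
        by (intro sum.cong refl) (simp only: shift[OF Su] L2_inner_op_adj_right[OF SB u z])
      finally show ?thesis .
    qed
    define p where "p i k = L2_inner M v (S i (R (op_adj M (S k) u)))" for i k
    have "L2_inner M v (induced_map M N Q R u) = (\<Sum>j\<in>{1..N}. L2_inner M v (Q j (R (op_adj M (Q j) u))))"
      by (rule L2_inner_induced_map[OF Q R u v])
    also have "\<dots> = (\<Sum>j\<in>{1..N}. \<Sum>i\<in>{1..N}. c i j * (\<Sum>k\<in>{1..N}. cnj (c k j) * p i k))"
      unfolding p_def
      by (intro sum.cong refl) (simp add: Q_right[OF _ bounded_op_in_L2[OF R Qu] v] SRQ)
    also have "\<dots> = (\<Sum>i\<in>{1..N}. \<Sum>j\<in>{1..N}. \<Sum>k\<in>{1..N}. (c i j * cnj (c k j)) * p i k)"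
      by (subst sum.swap) (simp only: sum_distrib_left mult.assoc)
    also have "\<dots> = (\<Sum>i\<in>{1..N}. \<Sum>k\<in>{1..N}. (\<Sum>j\<in>{1..N}. c i j * cnj (c k j)) * p i k)"
      by (rule sum.cong[OF refl], subst sum.swap) (simp only: sum_distrib_right)
    also have "\<dots> = (\<Sum>i\<in>{1..N}. \<Sum>k\<in>{1..N}. if i = k then p i k else 0)"
    proof (intro sum.cong refl)
      fix i k assume i: "i \<in> {1..N}" and k: "k \<in> {1..N}"
      show "(\<Sum>j\<in>{1..N}. c i j * cnj (c k j)) * p i k = (if i = k then p i k else 0)"
        by (simp only: unitary[OF i k]) simp
    qed
    also have "\<dots> = (\<Sum>i\<in>{1..N}. p i i)"
      by (intro sum.cong refl) simp
    also have "\<dots> = L2_inner M v (induced_map M N S R u)"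
      unfolding p_def by (rule L2_inner_induced_map[OF S R u v, symmetric])
    finally show "L2_inner M v (induced_map M N S R u) = L2_inner M v (induced_map M N Q R u)" ..
  qed
qed

theorem proposition4p5:
  fixes M :: "'a::t2_space measure"
    and \<alpha> :: "'a fclass \<Rightarrow> 'a fclass"
    and S Q :: "nat \<Rightarrow> 'a operator"
    and N :: nat
  assumes "compact (UNIV :: 'a set)"
    and "sets M = sets borel"
    and "prob_space M"
    and "regular_measure M"
    and "star_hom_Linf M \<alpha>"
    and "orthonormal_basis M \<alpha> N S"
    and "orthonormal_basis M \<alpha> N Q"
  shows "let U = (\<lambda>i j. module_inner M (S i) (Q j)) in
    unitary_Linf_matrix M N U \<and>
    (\<forall>j\<in>{1..N}. Q j = op_sum M (\<lambda>i. compose (L2 M) (S i) (U i j)) {1..N}) \<and>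
    (constant_matrix M N U \<longleftrightarrow>
      (\<forall>R\<in>bounded_ops M. induced_map M N S R = induced_map M N Q R))"
proof -
  note prob = assms(3) and hom = assms(5) and S = assms(6) and Q = assms(7)
  note SI = orthonormal_basis_intertwiner[OF S] and QI = orthonormal_basis_intertwiner[OF Q]
  note SB = orthonormal_basis_bounded[OF S] and QB = orthonormal_basis_bounded[OF Q]
  define U where "U i j = module_inner M (S i) (Q j)" for i j
  have "unitary_Linf_matrix M N U"
    unfolding unitary_Linf_matrix_def Linf_matrix_def
  proof (intro conjI ballI)
    fix i j assume i: "i \<in> {1..N}" and j: "j \<in> {1..N}"
    show "U i j \<in> mult_op M ` Linf M"
      unfolding U_def
      by (rule module_inner_in_Linf[OF prob_space.finite_measure[OF prob] hom SI[OF i] QI[OF j]])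
    have "op_sum M (\<lambda>k. compose (L2 M) (op_adj M (U k i)) (U k j)) {1..N}
        = op_sum M (\<lambda>k. compose (L2 M) (module_inner M (Q i) (S k)) (module_inner M (S k) (Q j))) {1..N}"
      by (rule op_sum_cong) (simp only: U_def op_adj_module_inner[OF SB QB[OF i]])
    also have "\<dots> = scalar_op M (if i = j then 1 else 0)"
      by (rule transition_matrix_unitary[OF S Q i j])
    finally show "op_sum M (\<lambda>k. compose (L2 M) (op_adj M (U k i)) (U k j)) {1..N}
        = scalar_op M (if i = j then 1 else 0)" .
    have "op_sum M (\<lambda>k. compose (L2 M) (U i k) (op_adj M (U j k))) {1..N}
        = op_sum M (\<lambda>k. compose (L2 M) (module_inner M (S i) (Q k)) (module_inner M (Q k) (S j))) {1..N}"
      by (rule op_sum_cong) (simp only: U_def op_adj_module_inner[OF SB[OF j] QB])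
    also have "\<dots> = scalar_op M (if i = j then 1 else 0)"
      by (rule transition_matrix_unitary[OF Q S i j])
    finally show "op_sum M (\<lambda>k. compose (L2 M) (U i k) (op_adj M (U j k))) {1..N}
        = scalar_op M (if i = j then 1 else 0)" .
  qed
  moreover have "\<forall>j\<in>{1..N}. Q j = op_sum M (\<lambda>i. compose (L2 M) (S i) (U i j)) {1..N}"
    using S QI unfolding orthonormal_basis_def U_def by blast
  moreover have "constant_matrix M N U \<longleftrightarrow>
      (\<forall>R\<in>bounded_ops M. induced_map M N S R = induced_map M N Q R)"
    unfolding U_def
    using constant_matrix_if_induced_map_eq[OF prob S Q] induced_map_eq_if_constant_matrix[OF prob S Q]
    by blast
  ultimately show ?thesis
    unfolding Let_def U_def by blast
qed

end
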